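(* Let $\gamma\in\{C_{max},\sum_jC_j\}$ and let $c\ge 0$ be a constant. The problem $P\,|\,or/and\text{-}prec,\,p_j=1\,|\,\gamma$ restricted to instances whose number of successors satisfies $k_s\le c$ is solvable in polynomial time.
   Context: An instance of $P\,|\,or/and\text{-}prec,\,p_j=1\,|\,\gamma$ consists of a set $J=\{1,\dots,n\}$ of unit-time jobs, a number $m$ of identical parallel machines, and for every job $j\in J$ a precedence constraint $\psi_j$, which is either the constant $\mathbb{1}$ ("true") or a Boolean formula in disjunctive normal form (a disjunction of conjunctions) over the unnegated variables $\{x_i : i\in J\}$. A schedule is a tuple $(C_j)_{j\in J}$ of completion times $C_j\in\{1,2,\dots\}$ with $|\{j\in J : C_j=t\}|\le m$ for every $t$. It is feasible if for every $j\in J$ the formula $\psi_j$ is satisfied by the assignment $x_i=1$ if $C_i<C_j$ and $x_i=0$ otherwise. All instances are assumed to admit a feasible schedule. The task is to find a feasible schedule minimizing the makespan $C_{max}=\max_j C_j$ or the sum of completion times $\sum_j C_j$, respectively. A job $j$ with $\psi_j\neq\mathbb{1}$ is called a successor, and $k_s$ is the number of successors. *)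

theory Defs
  imports "HOL-Library.Log_Nat" "HOL-Computational_Algebra.Polynomial"
begin

section \<open>Polynomial-time solvability\<close>

text \<open>
  The model of computation is the random access machine of Cook and Reckhow (Time bounded random
  access machines, 1973) with registers holding natural numbers, a sequential input tape and a
  sequential output tape.  The cost is uniform, which is legitimate since there is no
  multiplication: a step lengthens the binary representation of the largest number present by at
  most one bit (up to the constants in the program), so that polynomial time on this machine is
  polynomial time on a Turing machine.
\<close>

datatype instr =
    Const nat nat      \<comment> \<open>\<open>X\<^sub>i \<leftarrow> k\<close>\<close>
  | Add nat nat nat    \<comment> \<open>\<open>X\<^sub>i \<leftarrow> X\<^sub>j + X\<^sub>k\<close>\<close>
  | Sub nat nat nat    \<comment> \<open>\<open>X\<^sub>i \<leftarrow> max 0 (X\<^sub>j - X\<^sub>k)\<close>\<close>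
  | Load nat nat       \<comment> \<open>register \<open>i\<close> receives the contents of the register whose address is \<open>X\<^sub>j\<close>\<close>
  | Store nat nat      \<comment> \<open>the register whose address is \<open>X\<^sub>i\<close> receives \<open>X\<^sub>j\<close>\<close>
  | JumpPos nat nat    \<comment> \<open>if \<open>X\<^sub>j > 0\<close>, continue with instruction number \<open>l\<close>\<close>
  | Read nat
  | Print nat

type_synonym program = "instr list"

record config =
  pc :: nat
  reg :: "nat \<Rightarrow> nat"
  inp :: "nat list"
  outp :: "nat list"

text \<open>Reading beyond the end of the input yields 0.\<close>

fun exec :: "instr \<Rightarrow> config \<Rightarrow> config" where
  "exec (Const i k) s = s\<lparr>pc := pc s + 1, reg := (reg s)(i := k)\<rparr>"
| "exec (Add i j k) s = s\<lparr>pc := pc s + 1, reg := (reg s)(i := reg s j + reg s k)\<rparr>"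
| "exec (Sub i j k) s = s\<lparr>pc := pc s + 1, reg := (reg s)(i := reg s j - reg s k)\<rparr>"
| "exec (Load i j) s = s\<lparr>pc := pc s + 1, reg := (reg s)(i := reg s (reg s j))\<rparr>"
| "exec (Store i j) s = s\<lparr>pc := pc s + 1, reg := (reg s)(reg s i := reg s j)\<rparr>"
| "exec (JumpPos j l) s = s\<lparr>pc := (if reg s j > 0 then l else pc s + 1)\<rparr>"
| "exec (Read i) s =
     s\<lparr>pc := pc s + 1,
       reg := (reg s)(i := (case inp s of [] \<Rightarrow> 0 | x # _ \<Rightarrow> x)),
       inp := tl (inp s)\<rparr>"
| "exec (Print i) s = s\<lparr>pc := pc s + 1, outp := outp s @ [reg s i]\<rparr>"

definition halted :: "program \<Rightarrow> config \<Rightarrow> bool" where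
  "halted P s \<longleftrightarrow> length P \<le> pc s"

definition step :: "program \<Rightarrow> config \<Rightarrow> config" where
  "step P s = (if halted P s then s else exec (P ! pc s) s)"

definition initial :: "nat list \<Rightarrow> config" where
  "initial w = \<lparr>pc = 0, reg = (\<lambda>_. 0), inp = w, outp = []\<rparr>"

definition computes_within :: "program \<Rightarrow> nat list \<Rightarrow> nat \<Rightarrow> nat list \<Rightarrow> bool" where
  "computes_within P w t y \<longleftrightarrow>
     (let s = (step P ^^ t) (initial w) in halted P s \<and> outp s = y)"

text \<open>
  The length of the input with numbers written in binary, each followed by a separator;
  \<open>floorlog 2 x\<close> is the number of binary digits of \<open>x\<close>, the number 0 having none.
\<close>

definition input_size :: "nat list \<Rightarrow> nat" where
  "input_size w = (\<Sum>x\<leftarrow>w. floorlog 2 x + 1)"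

text \<open>
  A search problem is given by its set \<open>A\<close> of instances, their encodings, and for each instance
  the set of (encodings of) correct answers, one of which has to be found.
\<close>

definition poly_time_solvable ::
    "'a set \<Rightarrow> ('a \<Rightarrow> nat list) \<Rightarrow> ('a \<Rightarrow> nat list set) \<Rightarrow> bool" where
  "poly_time_solvable A enc answers \<longleftrightarrow>
     (\<exists>(P :: program) (p :: nat poly). \<forall>I\<in>A. \<exists>y\<in>answers I.
        computes_within P (enc I) (poly p (input_size (enc I))) y)"


section \<open>Unit-time scheduling with or/and-precedence constraints\<close>

text \<open>\<open>DNF F\<close> is the disjunction of the conjunctions of the variables in the members of \<open>F\<close>.\<close>

datatype formula = One | DNF "nat list list"

fun sat :: "(nat \<Rightarrow> bool) \<Rightarrow> formula \<Rightarrow> bool" where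
  "sat x One \<longleftrightarrow> True"
| "sat x (DNF F) \<longleftrightarrow> (\<exists>K\<in>set F. \<forall>i\<in>set K. x i)"

text \<open>
  Disjunctions and conjunctions are nonempty.  In particular no \<open>DNF\<close> formula is a tautology, so
  \<open>\<psi>\<^sub>j \<noteq> One\<close> means the same syntactically and semantically.
\<close>

fun wf_formula :: "nat set \<Rightarrow> formula \<Rightarrow> bool" where
  "wf_formula J One \<longleftrightarrow> True"
| "wf_formula J (DNF F) \<longleftrightarrow> F \<noteq> [] \<and> (\<forall>K\<in>set F. K \<noteq> [] \<and> set K \<subseteq> J)"

text \<open>The values of \<open>constr\<close> outside \<open>jobs\<close> are irrelevant.\<close>

record sched_instance =
  num_jobs :: nat
  machines :: nat
  constr :: "nat \<Rightarrow> formula"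

definition jobs :: "sched_instance \<Rightarrow> nat set" where
  "jobs I = {1..num_jobs I}"

definition is_schedule :: "sched_instance \<Rightarrow> (nat \<Rightarrow> nat) \<Rightarrow> bool" where
  "is_schedule I C \<longleftrightarrow>
     (\<forall>j\<in>jobs I. C j \<ge> 1) \<and> (\<forall>t. card {j \<in> jobs I. C j = t} \<le> machines I)"

definition feasible :: "sched_instance \<Rightarrow> (nat \<Rightarrow> nat) \<Rightarrow> bool" where
  "feasible I C \<longleftrightarrow>
     is_schedule I C \<and> (\<forall>j\<in>jobs I. sat (\<lambda>i. C i < C j) (constr I j))"

definition instances :: "sched_instance set" where
  "instances =
     {I. num_jobs I \<ge> 1 \<and> (\<forall>j\<in>jobs I. wf_formula (jobs I) (constr I j)) \<and> (\<exists>C. feasible I C)}"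

definition num_successors :: "sched_instance \<Rightarrow> nat" where
  "num_successors I = card {j \<in> jobs I. constr I j \<noteq> One}"

datatype objective = Makespan | Sum_Completion

fun cost :: "objective \<Rightarrow> sched_instance \<Rightarrow> (nat \<Rightarrow> nat) \<Rightarrow> nat" where
  "cost Makespan I C = Max (C ` jobs I)"
| "cost Sum_Completion I C = (\<Sum>j\<in>jobs I. C j)"

definition optimal :: "objective \<Rightarrow> sched_instance \<Rightarrow> (nat \<Rightarrow> nat) \<Rightarrow> bool" where
  "optimal \<gamma> I C \<longleftrightarrow> feasible I C \<and> (\<forall>C'. feasible I C' \<longrightarrow> cost \<gamma> I C \<le> cost \<gamma> I C')"

text \<open>In the encoding of a formula every list is preceded by its length.\<close>

fun encode_formula :: "formula \<Rightarrow> nat list" where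
  "encode_formula One = [0]"
| "encode_formula (DNF F) = 1 # length F # concat (map (\<lambda>K. length K # K) F)"

definition encode_instance :: "sched_instance \<Rightarrow> nat list" where
  "encode_instance I =
     num_jobs I # machines I #
       concat (map (\<lambda>j. encode_formula (constr I j)) [1..<num_jobs I + 1])"

definition encode_schedule :: "sched_instance \<Rightarrow> (nat \<Rightarrow> nat) \<Rightarrow> nat list" where
  "encode_schedule I C = map C [1..<num_jobs I + 1]"

end

(*
For each of the at most c successors, guess a conjunction of its formula and its completion time.
Schedules without idle times end by time n, so there are polynomially many guesses. A guess turns
the chosen conjunctions into deadlines for the other jobs. Put these jobs, in order of their
deadlines, into the first free slot. If a feasible schedule T agrees with the guess, no deadline is
missed: otherwise all slots before the deadline would be full, with jobs that T completes there as
well, and T would have to fit one more job. Moreover, for every t, at least as many jobs are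
completed by time t as in T, so that neither objective exceeds its value in T. Every candidate is
checked for feasibility, and a best one is kept.

The algorithm is written in a language with for-loops only, translated to the machine with its
exact running time. If no loop runs more often than a number N that never changes, a bound
polynomial in N follows from the nesting of the loops alone; only the reading of the input, which
determines N, needs its own time analysis.
*)
theory Submission
  imports Defs "HOL-Library.Countable"
begin

section \<open>A structured language with bounded loops\<close>

text \<open>The program depends on \<open>c\<close>: the guess takes 2c nested loops, so the degree
  of the time bound grows with \<open>c\<close>, while addresses of conjunctions and times are both
  enumerated below one number \<open>Bound\<close>. Correctness is split asymmetrically. Soundness
  has to cover every guess, also one that repeats a successor or points into the middle of a
  conjunction, so it rests on the tests alone. Completeness concerns the single guess read off from
  a schedule \<open>T\<close>, and there the tests must be shown to pass. This is why the greedy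
  phase is analysed with two invariants: bookkeeping for arbitrary guesses, and
  \<open>edf_inv\<close> for the right one. Deadlines are strict, since a literal must be completed
  before the successor that relies on it. A successor may be a literal of another successor and then
  gets a deadline too; it is not moved, and \<open>T\<close> itself shows that it is in time. The
  program cannot recognise the right guess; it suffices that the run meets it at some point and that
  the recorded cost never increases afterwards.\<close>

datatype var = NumJobs | Machines | Bound | Ptr | Tag | Len | LitLen | Lit
  | Count | Guess | Slot | Pos | Idx | Job | Deadline | Time | Place
  | Ok | Cost | Found | BestCost

text \<open>Provides the injection \<open>to_nat\<close>, by which \<open>vreg\<close> assigns
  registers to variables.\<close>

instance var :: countable
  by countable_datatype

datatype array = Token | Owner | Succ | GuessPos | GuessTime | Compl | Due | Load_at | Best

datatype exp = Num nat | Var var | Arr array exp | Plus exp exp | Minus exp exp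

datatype cmd =
    Skip
  | Assign var exp
  | Write array exp exp
  | Seq cmd cmd  (infixr \<open>;;\<close> 60)
  | Cond exp cmd cmd
  | For var exp cmd
  | Input var
  | Output exp

record state =
  vr :: "var \<Rightarrow> nat"
  ar :: "array \<Rightarrow> nat \<Rightarrow> nat"
  inq :: "nat list"
  outq :: "nat list"

abbreviation set_var :: "var \<Rightarrow> nat \<Rightarrow> state \<Rightarrow> state" where
  "set_var x k s \<equiv> s\<lparr>vr := (vr s)(x := k)\<rparr>"

primrec eval :: "exp \<Rightarrow> state \<Rightarrow> nat" where
  "eval (Num k) s = k"
| "eval (Var x) s = vr s x"
| "eval (Arr a e) s = ar s a (eval e s)"
| "eval (Plus e f) s = eval e s + eval f s"
| "eval (Minus e f) s = eval e s - eval f s"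

primrec iter :: "(nat \<Rightarrow> 'a \<Rightarrow> 'a) \<Rightarrow> nat \<Rightarrow> 'a \<Rightarrow> 'a" where
  "iter f 0 s = s"
| "iter f (Suc k) s = f k (iter f k s)"

text \<open>The bound of a loop is evaluated once, and assignments to the loop variable in the body do
  not affect the iteration.\<close>

primrec run :: "cmd \<Rightarrow> state \<Rightarrow> state" where
  "run Skip s = s"
| "run (Assign x e) s = set_var x (eval e s) s"
| "run (Write a e f) s = s\<lparr>ar := (ar s)(a := (ar s a)(eval e s := eval f s))\<rparr>"
| "run (c ;; d) s = run d (run c s)"
| "run (Cond e c d) s = (if eval e s > 0 then run c s else run d s)"
| "run (For x e c) s = iter (\<lambda>i s. run c (set_var x i s)) (eval e s) s"
| "run (Input x) s = set_var x (case inq s of [] \<Rightarrow> 0 | y # _ \<Rightarrow> y) (s\<lparr>inq := tl (inq s)\<rparr>)"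
| "run (Output e) s = s\<lparr>outq := outq s @ [eval e s]\<rparr>"

text \<open>Expressions compile to code without jumps, so this is both the length of the code and
  the number of steps it takes. The 7 for an array access are four doublings, loading and adding the
  array code, and the final \<open>Load\<close>.\<close>

primrec exp_size :: "exp \<Rightarrow> nat" where
  "exp_size (Num k) = 1"
| "exp_size (Var x) = 2"
| "exp_size (Arr a e) = exp_size e + 7"
| "exp_size (Plus e f) = exp_size e + exp_size f + 1"
| "exp_size (Minus e f) = exp_size e + exp_size f + 1"

text \<open>The constants count instructions of \<open>compile\<close>. In a conditional the else
  branch stands first and needs two more instructions to jump over the other branch. A loop takes 3
  steps to set up its registers and 4 for the last, failing test; each round takes 4 steps before
  the body and 3 after it.\<close>

primrec time :: "cmd \<Rightarrow> state \<Rightarrow> nat" where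
  "time Skip s = 0"
| "time (Assign x e) s = exp_size e + 2"
| "time (Write a e f) s = exp_size e + exp_size f + 7"
| "time (c ;; d) s = time c s + time d (run c s)"
| "time (Cond e c d) s = exp_size e + (if eval e s > 0 then 1 + time c s else 3 + time d s)"
| "time (For x e c) s = exp_size e + 7 +
     (\<Sum>i<eval e s. 7 + time c (set_var x i (iter (\<lambda>i s. run c (set_var x i s)) i s)))"
| "time (Input x) s = 1"
| "time (Output e) s = exp_size e + 1"

subsection \<open>Compilation\<close>

fun array_code :: "array \<Rightarrow> nat" where
  "array_code Token = 0"
| "array_code Owner = 1"
| "array_code Succ = 2"
| "array_code GuessPos = 3"
| "array_code GuessTime = 4"
| "array_code Compl = 5"
| "array_code Due = 6"
| "array_code Load_at = 7"
| "array_code Best = 8"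

text \<open>Registers are split by their address modulo 16; multiplying an index by 16 takes four
  doublings.\<close>

definition cell :: "array \<Rightarrow> nat \<Rightarrow> nat" where "cell a i = 16 * i + array_code a"
definition vreg :: "var \<Rightarrow> nat" where "vreg x = 16 * to_nat x + 15"
definition tmp :: "nat \<Rightarrow> nat" where "tmp d = 16 * d + 14"
definition cap :: "nat \<Rightarrow> nat" where "cap d = 16 * d + 13"
definition ctr :: "nat \<Rightarrow> nat" where "ctr d = 16 * d + 12"

text \<open>The residues 12 to 15 are reserved for \<open>ctr\<close>, \<open>cap\<close>,
  \<open>tmp\<close> and \<open>vreg\<close>, so array cells cannot collide with them.\<close>

lemma array_code_less: "array_code a < 12"
  by (cases a) auto

lemma array_code_eq_iff [simp]: "array_code a = array_code b \<longleftrightarrow> a = b"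
  by (cases a; cases b) auto

lemma mod_16 [simp]:
  "cell a i mod 16 = array_code a" "vreg x mod 16 = 15" "tmp d mod 16 = 14"
  "cap d mod 16 = 13" "ctr d mod 16 = 12"
  using array_code_less[of a] by (simp_all add: cell_def vreg_def tmp_def cap_def ctr_def)

lemma neq_if_mod_neq: "x mod k \<noteq> y mod k \<Longrightarrow> x \<noteq> (y::nat)"
  by blast

lemma distinct_registers [simp]:
  "cell a i \<noteq> vreg x" "cell a i \<noteq> tmp d" "cell a i \<noteq> cap d" "cell a i \<noteq> ctr d"
  "vreg x \<noteq> cell a i" "tmp d \<noteq> cell a i" "cap d \<noteq> cell a i" "ctr d \<noteq> cell a i"
  "vreg x \<noteq> tmp d" "vreg x \<noteq> cap d" "vreg x \<noteq> ctr d"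
  "tmp d \<noteq> vreg x" "cap d \<noteq> vreg x" "ctr d \<noteq> vreg x"
  "tmp d \<noteq> cap d'" "tmp d \<noteq> ctr d'" "cap d' \<noteq> tmp d" "ctr d' \<noteq> tmp d"
  "cap d \<noteq> ctr d'" "ctr d' \<noteq> cap d"
  by (rule neq_if_mod_neq[of _ 16], use array_code_less[of a] in simp)+

lemma register_eq_iff [simp]:
  "vreg x = vreg y \<longleftrightarrow> x = y" "tmp d = tmp d' \<longleftrightarrow> d = d'" "cap d = cap d' \<longleftrightarrow> d = d'"
  "ctr d = ctr d' \<longleftrightarrow> d = d'"
  by (simp_all add: vreg_def tmp_def cap_def ctr_def)

lemma cell_eq_iff [simp]: "cell a i = cell b k \<longleftrightarrow> a = b \<and> i = k"
proof
  assume eq: "cell a i = cell b k"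
  then have "array_code a = array_code b"
    by (metis mod_16(1))
  with eq show "a = b \<and> i = k"
    by (simp add: cell_def)
qed simp

primrec comp_exp :: "exp \<Rightarrow> nat \<Rightarrow> program" where
  "comp_exp (Num k) d = [Const (tmp d) k]"
| "comp_exp (Var x) d = [Const (tmp d) 0, Add (tmp d) (vreg x) (tmp d)]"
| "comp_exp (Arr a e) d = comp_exp e d @ replicate 4 (Add (tmp d) (tmp d) (tmp d)) @
     [Const (tmp (d + 1)) (array_code a), Add (tmp d) (tmp d) (tmp (d + 1)), Load (tmp d) (tmp d)]"
| "comp_exp (Plus e f) d = comp_exp e d @ comp_exp f (d + 1) @ [Add (tmp d) (tmp d) (tmp (d + 1))]"
| "comp_exp (Minus e f) d = comp_exp e d @ comp_exp f (d + 1) @ [Sub (tmp d) (tmp d) (tmp (d + 1))]"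

text \<open>Code lengths are defined ahead of the code because \<open>compile\<close> computes its
  jump targets from them.\<close>

primrec cmd_size :: "cmd \<Rightarrow> nat" where
  "cmd_size Skip = 0"
| "cmd_size (Assign x e) = exp_size e + 2"
| "cmd_size (Write a e f) = exp_size e + exp_size f + 7"
| "cmd_size (c ;; d) = cmd_size c + cmd_size d"
| "cmd_size (Cond e c d) = exp_size e + 3 + cmd_size d + cmd_size c"
| "cmd_size (For x e c) = exp_size e + 12 + cmd_size c"
| "cmd_size (Input x) = 1"
| "cmd_size (Output e) = exp_size e + 1"

text \<open>The code for a command depends on the address \<open>p\<close> at which it starts and on the number
  \<open>d\<close> of enclosing loops.\<close>

primrec compile :: "cmd \<Rightarrow> nat \<Rightarrow> nat \<Rightarrow> program" where
  "compile Skip p d = []"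
| "compile (Assign x e) p d = comp_exp e 0 @ [Const (tmp 1) 0, Add (vreg x) (tmp 0) (tmp 1)]"
| "compile (Write a e f) p d = comp_exp e 0 @ replicate 4 (Add (tmp 0) (tmp 0) (tmp 0)) @
     [Const (tmp 1) (array_code a), Add (tmp 0) (tmp 0) (tmp 1)] @ comp_exp f 1 @
     [Store (tmp 0) (tmp 1)]"
| "compile (c ;; c') p d = compile c p d @ compile c' (p + cmd_size c) d"
| "compile (Cond e c c') p d = 
     comp_exp e 0 @ [JumpPos (tmp 0) (p + exp_size e + 3 + cmd_size c')] @
     compile c' (p + exp_size e + 1) d @
     [Const (tmp 0) 1, JumpPos (tmp 0) (p + exp_size e + 3 + cmd_size c' + cmd_size c)] @
     compile c (p + exp_size e + 3 + cmd_size c') d"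
| "compile (For x e c) p d = 
     comp_exp e 0 @ [Const (tmp 1) 0, Add (cap d) (tmp 0) (tmp 1), Const (ctr d) 0] @
     [Sub (tmp 0) (cap d) (ctr d), JumpPos (tmp 0) (p + exp_size e + 7),
      Const (tmp 0) 1, JumpPos (tmp 0) (p + exp_size e + 12 + cmd_size c)] @
     [Const (tmp 0) 0, Add (vreg x) (ctr d) (tmp 0)] @
     compile c (p + exp_size e + 9) (d + 1) @
     [Const (tmp 0) 1, Add (ctr d) (ctr d) (tmp 0), JumpPos (tmp 0) (p + exp_size e + 3)]"
| "compile (Input x) p d = [Read (vreg x)]"
| "compile (Output e) p d = comp_exp e 0 @ [Print (tmp 0)]"

lemma length_comp_exp [simp]: "length (comp_exp e d) = exp_size e"
  by (induction e arbitrary: d) auto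

lemma length_comp [simp]: "length (compile c p d) = cmd_size c"
  by (induction c arbitrary: p d) auto

section \<open>Executing a piece of code inside a larger program\<close>

definition code_at :: "program \<Rightarrow> nat \<Rightarrow> program \<Rightarrow> bool" where
  "code_at P p is \<longleftrightarrow> (\<forall>i<length is. p + i < length P \<and> P ! (p + i) = is ! i)"

lemma code_at_Nil [simp]: "code_at P p []"
  by (simp add: code_at_def)

lemma code_at_Cons [simp]:
  "code_at P p (i # is) \<longleftrightarrow> p < length P \<and> P ! p = i \<and> code_at P (Suc p) is"
  unfolding code_at_def by (auto simp: less_Suc_eq_0_disj)

lemma code_at_append [simp]:
  "code_at P p (is @ js) \<longleftrightarrow> code_at P p is \<and> code_at P (p + length is) js"
  by (induction "is" arbitrary: p) auto

fun straight :: "instr \<Rightarrow> bool" where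
  "straight (JumpPos j l) \<longleftrightarrow> False"
| "straight _ \<longleftrightarrow> True"

lemma pc_exec_straight: "straight i \<Longrightarrow> pc (exec i s) = pc s + 1"
  by (cases i) auto

text \<open>Replaces machine steps by \<open>fold exec\<close>, which the simplifier can evaluate
  instruction by instruction.\<close>

lemma funpow_step_straight:
  assumes "code_at P (pc s) is" "\<forall>i\<in>set is. straight i"
  shows "(step P ^^ length is) s = fold exec is s"
  using assms
proof (induction "is" arbitrary: s)
  case (Cons i "is")
  have "step P s = exec i s"
    using Cons.prems by (simp add: step_def halted_def)
  then have "(step P ^^ length (i # is)) s = (step P ^^ length is) (exec i s)"
    by (simp add: funpow_Suc_right del: funpow.simps)
  with Cons show ?case
    by (simp add: pc_exec_straight)
qed simp

lemma straight_comp_exp: "i \<in> set (comp_exp e d) \<Longrightarrow> straight i"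
  by (induction e arbitrary: d) auto

text \<open>The program counter and the registers \<open>tmp\<close>, \<open>cap\<close> and
  \<open>ctr\<close> are left open: they belong to the compiled code and have no counterpart in a
  \<open>state\<close>.\<close>

definition represents :: "config \<Rightarrow> state \<Rightarrow> bool" where
  "represents s st \<longleftrightarrow> (\<forall>x. reg s (vreg x) = vr st x) \<and> (\<forall>a i. reg s (cell a i) = ar st a i) \<and>
     inp s = inq st \<and> outp s = outq st"

text \<open>The temporaries form a stack. Code for an expression at depth \<open>d\<close> disturbs
  only those from \<open>d\<close> on, so a left operand in \<open>tmp d\<close> survives the
  evaluation of the right operand at depth \<open>d + 1\<close>.\<close>

definition same_but_tmp :: "nat \<Rightarrow> (nat \<Rightarrow> nat) \<Rightarrow> (nat \<Rightarrow> nat) \<Rightarrow> bool" where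
  "same_but_tmp d r r' \<longleftrightarrow> (\<forall>k. (\<forall>d'\<ge>d. k \<noteq> tmp d') \<longrightarrow> r' k = r k)"

lemma same_but_tmpD:
  assumes "same_but_tmp d r r'"
  shows "r' (cell a i) = r (cell a i)" "r' (vreg x) = r (vreg x)" "r' (cap e) = r (cap e)"
    "r' (ctr e) = r (ctr e)" "e < d \<Longrightarrow> r' (tmp e) = r (tmp e)"
  using assms by (auto simp: same_but_tmp_def)

lemma same_but_tmp_refl [simp]: "same_but_tmp d r r"
  by (simp add: same_but_tmp_def)

lemma same_but_tmp_trans:
  "same_but_tmp d r r' \<Longrightarrow> same_but_tmp d' r' r'' \<Longrightarrow> d \<le> d' \<Longrightarrow> same_but_tmp d r r''"
  by (simp add: same_but_tmp_def)

lemma same_but_tmp_upd [simp]: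
  "same_but_tmp d r r' \<Longrightarrow> d \<le> d' \<Longrightarrow> same_but_tmp d r (r'(tmp d' := v))"
  by (simp add: same_but_tmp_def)

lemma represents_same_but_tmp:
  assumes "represents s st" "same_but_tmp d (reg s) r"
  shows "represents (s\<lparr>pc := p, reg := r\<rparr>) st"
  using assms(1) same_but_tmpD[OF assms(2)] by (simp add: represents_def)

lemma comp_exp_correct:
  assumes "represents s st"
  shows "\<exists>r. fold exec (comp_exp e d) s = s\<lparr>pc := pc s + exp_size e, reg := r\<rparr> \<and>
           r (tmp d) = eval e st \<and> same_but_tmp d (reg s) r"
  using assms
proof (induction e arbitrary: d s)
  case (Arr a e)
  then obtain r where r: "fold exec (comp_exp e d) s = s\<lparr>pc := pc s + exp_size e, reg := r\<rparr>"
    "r (tmp d) = eval e st" "same_but_tmp d (reg s) r"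
    by blast
  have cell: "r (cell a (eval e st)) = ar st a (eval e st)"
    using same_but_tmpD(1)[OF r(3)] Arr.prems by (simp add: represents_def)
  \<comment> \<open>The left-hand side is the form in which simplification leaves four doublings of
    \<open>x\<close>.\<close>
  have addr: "x + x + (x + x) + (x + x + (x + x)) + (x + x + (x + x) + (x + x + (x + x))) +
      array_code a = cell a x" for x
    by (simp add: cell_def)
  let ?r = "r(tmp (d+1) := array_code a, tmp d := ar st a (eval e st))"
  have "fold exec (comp_exp (Arr a e) d) s = s\<lparr>pc := pc s + exp_size (Arr a e), reg := ?r\<rparr>"
    using r cell by (simp add: numeral_eq_Suc addr fun_eq_iff)
  moreover have "?r (tmp d) = eval (Arr a e) st" "same_but_tmp d (reg s) ?r"
    using r(3) by (simp_all del: fun_upd_apply) simp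
  ultimately show ?case
    by blast
next
  case (Plus e f)
  then obtain r where r: "fold exec (comp_exp e d) s = s\<lparr>pc := pc s + exp_size e, reg := r\<rparr>"
    "r (tmp d) = eval e st" "same_but_tmp d (reg s) r"
    by blast
  let ?s = "s\<lparr>pc := pc s + exp_size e, reg := r\<rparr>"
  have "represents ?s st"
    using Plus.prems r(3) by (rule represents_same_but_tmp)
  then obtain r' where r': "fold exec (comp_exp f (d+1)) ?s = ?s\<lparr>pc := pc ?s + exp_size f, reg := r'\<rparr>"
    "r' (tmp (d+1)) = eval f st" "same_but_tmp (d+1) (reg ?s) r'"
    using Plus.IH(2)[of ?s "d+1"] by blast
  let ?r = "r'(tmp d := eval e st + eval f st)"
  have "same_but_tmp d (reg s) r'"
    using same_but_tmp_trans[OF r(3), of "d+1" r'] r'(3) by simp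
  moreover have "r' (tmp d) = eval e st"
    using same_but_tmpD(5)[OF r'(3), of d] r(2) by simp
  ultimately have
    "fold exec (comp_exp (Plus e f) d) s = s\<lparr>pc := pc s + exp_size (Plus e f), reg := ?r\<rparr>"
    "?r (tmp d) = eval (Plus e f) st" "same_but_tmp d (reg s) ?r"
    using r(1) r'(1,2) by simp_all
  then show ?case
    by blast
next
  case (Minus e f)
  then obtain r where r: "fold exec (comp_exp e d) s = s\<lparr>pc := pc s + exp_size e, reg := r\<rparr>"
    "r (tmp d) = eval e st" "same_but_tmp d (reg s) r"
    by blast
  let ?s = "s\<lparr>pc := pc s + exp_size e, reg := r\<rparr>"
  have "represents ?s st"
    using Minus.prems r(3) by (rule represents_same_but_tmp)
  then obtain r' where r': "fold exec (comp_exp f (d+1)) ?s = ?s\<lparr>pc := pc ?s + exp_size f, reg := r'\<rparr>"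
    "r' (tmp (d+1)) = eval f st" "same_but_tmp (d+1) (reg ?s) r'"
    using Minus.IH(2)[of ?s "d+1"] by blast
  let ?r = "r'(tmp d := eval e st - eval f st)"
  have "same_but_tmp d (reg s) r'"
    using same_but_tmp_trans[OF r(3), of "d+1" r'] r'(3) by simp
  moreover have "r' (tmp d) = eval e st"
    using same_but_tmpD(5)[OF r'(3), of d] r(2) by simp
  ultimately have
    "fold exec (comp_exp (Minus e f) d) s = s\<lparr>pc := pc s + exp_size (Minus e f), reg := ?r\<rparr>"
    "?r (tmp d) = eval (Minus e f) st" "same_but_tmp d (reg s) ?r"
    using r(1) r'(1,2) by simp_all
  then show ?case
    by blast
next
  case (Num k)
  have "same_but_tmp d (reg s) ((reg s)(tmp d := k))"
    by simp
  then show ?case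
    by fastforce
next
  case (Var x)
  have "same_but_tmp d (reg s) ((reg s)(tmp d := vr st x))"
    by simp
  moreover have "reg s (vreg x) = vr st x"
    using Var by (simp add: represents_def)
  ultimately show ?case
    by fastforce
qed

lemma comp_exp_steps:
  assumes "represents s st" "code_at P (pc s) (comp_exp e d)"
  obtains r where "(step P ^^ exp_size e) s = s\<lparr>pc := pc s + exp_size e, reg := r\<rparr>"
    "r (tmp d) = eval e st" "same_but_tmp d (reg s) r"
    "represents (s\<lparr>pc := pc s + exp_size e, reg := r\<rparr>) st"
proof -
  have "(step P ^^ exp_size e) s = fold exec (comp_exp e d) s"
    using funpow_step_straight[OF assms(2)] straight_comp_exp by simp
  then show thesis
    using that comp_exp_correct[OF assms(1), of e d] represents_same_but_tmp[OF assms(1)] by metis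
qed

lemma funpow_add_apply: "(f ^^ (a + b)) s = (f ^^ b) ((f ^^ a) s)"
  by (metis add.commute comp_apply funpow_add)

text \<open>A loop at nesting depth \<open>d\<close> owns \<open>cap d\<close> and
  \<open>ctr d\<close> and compiles its body at depth \<open>d + 1\<close>; this property of the
  body is what preserves the bound and the counter of the loop.\<close>

definition keeps_loops :: "nat \<Rightarrow> config \<Rightarrow> config \<Rightarrow> bool" where
  "keeps_loops d s s' \<longleftrightarrow>
     (\<forall>d'<d. reg s' (cap d') = reg s (cap d') \<and> reg s' (ctr d') = reg s (ctr d'))"

lemma keeps_loops_trans:
  "keeps_loops d s s' \<Longrightarrow> keeps_loops d s' s'' \<Longrightarrow> keeps_loops d s s''"
  by (simp add: keeps_loops_def)

lemma keeps_loops_same_but_tmp: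
  "same_but_tmp e (reg s) r \<Longrightarrow> keeps_loops d s (s\<lparr>pc := p, reg := r\<rparr>)"
  using same_but_tmpD by (simp add: keeps_loops_def)

lemma step_exec: "code_at P (pc s) [i] \<Longrightarrow> step P s = exec i s"
  by (simp add: step_def halted_def)

lemma funpow_1_apply: "((f :: 'a \<Rightarrow> 'a) ^^ 1) s = f s"
  by simp

text \<open>The number of steps is exact rather than bounded because a fragment in the middle of a
  program does not halt: only exact counts let the runs of consecutive fragments be joined by
  \<open>funpow_add_apply\<close>.\<close>

theorem compile_correct:
  assumes "code_at P (pc s) (compile c (pc s) d)" "represents s st"
  shows "\<exists>s'. (step P ^^ time c st) s = s' \<and> pc s' = pc s + cmd_size c \<and>
           represents s' (run c st) \<and> keeps_loops d s s'"
  using assms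
proof (induction c arbitrary: s st d)
  case Skip
  then show ?case by (simp add: keeps_loops_def)
next
  case (Assign x e)
  have "code_at P (pc s) (comp_exp e 0)"
    using Assign.prems by simp
  from comp_exp_steps[OF Assign.prems(2) this] obtain r where
    r: "(step P ^^ exp_size e) s = s\<lparr>pc := pc s + exp_size e, reg := r\<rparr>"
    "r (tmp 0) = eval e st" "same_but_tmp 0 (reg s) r" by blast
  let ?s = "s\<lparr>pc := pc s + exp_size e, reg := r\<rparr>"
  let ?c = "[Const (tmp 1) 0, Add (vreg x) (tmp 0) (tmp 1)]"
  let ?s' = "s\<lparr>pc := pc s + exp_size e + 2, reg := r(tmp 1 := 0, vreg x := eval e st)\<rparr>"
  have "(step P ^^ length ?c) ?s = fold exec ?c ?s"
    using Assign.prems by (intro funpow_step_straight) auto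
  also have "\<dots> = ?s'"
    using r by simp
  finally have "(step P ^^ 2) ?s = ?s'"
    by (simp add: numeral_2_eq_2)
  then have "(step P ^^ time (Assign x e) st) s = ?s'"
    using r(1) by (simp only: time.simps funpow_add_apply)
  moreover have "represents ?s' (run (Assign x e) st)"
    using Assign.prems same_but_tmpD[OF r(3)] by (simp add: represents_def)
  moreover have "keeps_loops d s ?s'"
    using same_but_tmpD[OF r(3)] by (simp add: keeps_loops_def)
  ultimately show ?case
    by simp
next
  case (Write a e f)
  let ?c = "replicate 4 (Add (tmp 0) (tmp 0) (tmp 0)) @
     [Const (tmp 1) (array_code a), Add (tmp 0) (tmp 0) (tmp 1)]"
  have "code_at P (pc s) (comp_exp e 0)"
    using Write.prems by simp
  from comp_exp_steps[OF Write.prems(2) this] obtain r where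
    r: "(step P ^^ exp_size e) s = s\<lparr>pc := pc s + exp_size e, reg := r\<rparr>"
    "r (tmp 0) = eval e st" "same_but_tmp 0 (reg s) r"
    "represents (s\<lparr>pc := pc s + exp_size e, reg := r\<rparr>) st" by blast
  let ?s = "s\<lparr>pc := pc s + exp_size e, reg := r\<rparr>"
  let ?r = "r(tmp 1 := array_code a, tmp 0 := cell a (eval e st))"
  let ?s1 = "s\<lparr>pc := pc s + exp_size e + 6, reg := ?r\<rparr>"
  have addr: "x + x + (x + x) + (x + x + (x + x)) + (x + x + (x + x) + (x + x + (x + x))) +
      array_code a = cell a x" for x
    by (simp add: cell_def)
  have "(step P ^^ length ?c) ?s = fold exec ?c ?s"
    using Write.prems by (intro funpow_step_straight) auto
  also have "\<dots> = ?s1"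
    using r by (simp add: numeral_eq_Suc addr fun_eq_iff)
  finally have 1: "(step P ^^ 6) ?s = ?s1"
    by simp
  have "represents ?s1 st"
    using r(4) by (simp add: represents_def)
  moreover have "code_at P (pc ?s1) (comp_exp f 1)"
    using Write.prems by (simp add: numeral_eq_Suc)
  ultimately obtain r' where
    r': "(step P ^^ exp_size f) ?s1 = ?s1\<lparr>pc := pc ?s1 + exp_size f, reg := r'\<rparr>"
    "r' (tmp 1) = eval f st" "same_but_tmp 1 (reg ?s1) r'"
    "represents (?s1\<lparr>pc := pc ?s1 + exp_size f, reg := r'\<rparr>) st"
    by (rule comp_exp_steps)
  let ?s2 = "s\<lparr>pc := pc s + exp_size e + 6 + exp_size f, reg := r'\<rparr>"
  let ?s3 = "s\<lparr>pc := pc s + exp_size e + 7 + exp_size f,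
     reg := r'(cell a (eval e st) := eval f st)\<rparr>"
  have "r' (tmp 0) = cell a (eval e st)"
    using same_but_tmpD(5)[OF r'(3), of 0] by simp
  moreover have "step P ?s2 = exec (Store (tmp 0) (tmp 1)) ?s2"
    using Write.prems by (intro step_exec) (simp add: numeral_eq_Suc algebra_simps)
  ultimately have 2: "step P ?s2 = ?s3"
    using r'(2) by simp
  have "time (Write a e f) st = exp_size e + (6 + (exp_size f + 1))"
    by simp
  then have "(step P ^^ time (Write a e f) st) s = ?s3"
    using r(1) 1 r'(1) 2 by (simp only: funpow_add_apply) simp
  moreover have "represents ?s3 (run (Write a e f) st)"
    using r'(4) by (auto simp: represents_def)
  moreover have "keeps_loops d s ?s3"
    using same_but_tmpD[OF r(3)] same_but_tmpD[OF r'(3)] by (simp add: keeps_loops_def)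
  ultimately show ?case
    by simp
next
  case (Seq c c')
  have "code_at P (pc s) (compile c (pc s) d)"
    using Seq.prems by simp
  from Seq.IH(1)[OF this Seq.prems(2)] obtain s1 where
    s1: "(step P ^^ time c st) s = s1" "pc s1 = pc s + cmd_size c"
    "represents s1 (run c st)" "keeps_loops d s s1" by blast
  have "code_at P (pc s1) (compile c' (pc s1) d)"
    using Seq.prems s1 by simp
  from Seq.IH(2)[OF this s1(3)] obtain s2 where
    s2: "(step P ^^ time c' (run c st)) s1 = s2" "pc s2 = pc s1 + cmd_size c'"
    "represents s2 (run c' (run c st))" "keeps_loops d s1 s2" by blast
  then show ?case
    using s1 keeps_loops_trans[OF s1(4) s2(4)] by (simp add: funpow_add_apply)
next
  case (Cond e c c')
  have "code_at P (pc s) (comp_exp e 0)"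
    using Cond.prems by simp
  from comp_exp_steps[OF Cond.prems(2) this] obtain r where
    r: "(step P ^^ exp_size e) s = s\<lparr>pc := pc s + exp_size e, reg := r\<rparr>"
    "r (tmp 0) = eval e st" "same_but_tmp 0 (reg s) r" by blast
  let ?s = "s\<lparr>pc := pc s + exp_size e, reg := r\<rparr>"
  have jump: "step P ?s = exec (JumpPos (tmp 0) (pc s + exp_size e + 3 + cmd_size c')) ?s"
    using Cond.prems by (intro step_exec) simp
  show ?case
  proof (cases "eval e st > 0")
    case True
    let ?s1 = "s\<lparr>pc := pc s + exp_size e + 3 + cmd_size c', reg := r\<rparr>"
    have "step P ?s = ?s1"
      using jump True r(2) by simp
    have "code_at P (pc ?s1) (compile c (pc ?s1) d)"
      using Cond.prems by (simp add: numeral_eq_Suc algebra_simps)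
    from Cond.IH(1)[OF this represents_same_but_tmp[OF Cond.prems(2) r(3)]] obtain s' where
      s': "(step P ^^ time c st) ?s1 = s'" "pc s' = pc ?s1 + cmd_size c"
      "represents s' (run c st)" "keeps_loops d ?s1 s'" by blast
    have "time (Cond e c c') st = exp_size e + (1 + time c st)"
      using True by simp
    then have "(step P ^^ time (Cond e c c') st) s = s'"
      using r(1) \<open>step P ?s = ?s1\<close> s'(1) by (simp only: funpow_add_apply) simp
    with True s' show ?thesis
      using keeps_loops_trans[OF keeps_loops_same_but_tmp[OF r(3)] s'(4)] by simp
  next
    case False
    let ?s1 = "s\<lparr>pc := pc s + exp_size e + 1, reg := r\<rparr>"
    have "step P ?s = ?s1"
      using jump False r(2) by simp
    have "code_at P (pc ?s1) (compile c' (pc ?s1) d)"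
      using Cond.prems by (simp add: numeral_eq_Suc algebra_simps)
    from Cond.IH(2)[OF this represents_same_but_tmp[OF Cond.prems(2) r(3)]] obtain s' where
      s': "(step P ^^ time c' st) ?s1 = s'" "pc s' = pc ?s1 + cmd_size c'"
      "represents s' (run c' st)" "keeps_loops d ?s1 s'" by blast
    let ?l = "pc s + exp_size e + 3 + cmd_size c' + cmd_size c"
    let ?s2 = "exec (JumpPos (tmp 0) ?l) (exec (Const (tmp 0) 1) s')"
    have "step P s' = exec (Const (tmp 0) 1) s'"
      using Cond.prems s'(2) by (intro step_exec) (simp add: numeral_eq_Suc algebra_simps)
    moreover have "step P (exec (Const (tmp 0) 1) s') = ?s2"
      using Cond.prems s'(2) by (intro step_exec) (simp add: numeral_eq_Suc algebra_simps)
    ultimately have "(step P ^^ 2) s' = ?s2"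
      by (simp add: numeral_2_eq_2)
    moreover have "time (Cond e c c') st = exp_size e + (1 + (time c' st + 2))"
      using False by simp
    ultimately have "(step P ^^ time (Cond e c c') st) s = ?s2"
      using r(1) \<open>step P ?s = ?s1\<close> s'(1) by (simp only: funpow_add_apply) simp
    moreover have "represents ?s2 (run (Cond e c c') st)"
      using False s'(3) by (simp add: represents_def)
    moreover have "keeps_loops d s ?s2"
      using keeps_loops_trans[OF keeps_loops_same_but_tmp[OF r(3)] s'(4)]
      by (simp add: keeps_loops_def)
    ultimately show ?thesis
      by simp
  qed
next
  case (For x e c)
  let ?f = "\<lambda>i st. run c (set_var x i st)"
  let ?b = "eval e st"
  let ?p = "pc s + exp_size e + 3"
  have "code_at P (pc s) (comp_exp e 0)"
    using For.prems by simp
  from comp_exp_steps[OF For.prems(2) this] obtain r where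
    r: "(step P ^^ exp_size e) s = s\<lparr>pc := pc s + exp_size e, reg := r\<rparr>"
    "r (tmp 0) = eval e st" "same_but_tmp 0 (reg s) r" by blast
  let ?s = "s\<lparr>pc := pc s + exp_size e, reg := r\<rparr>"
  let ?c = "[Const (tmp 1) 0, Add (cap d) (tmp 0) (tmp 1), Const (ctr d) 0]"
  let ?init = "s\<lparr>pc := ?p, reg := r(tmp 1 := 0, cap d := ?b, ctr d := 0)\<rparr>"
  \<comment> \<open>\<open>T k\<close> is the moment at which the loop test is reached with counter
    \<open>k\<close>.\<close>
  define T where "T k = exp_size e + 3 + (\<Sum>i<k. 7 + time c (set_var x i (iter ?f i st)))" for k
  have "code_at P (pc ?s) ?c"
    using For.prems(1) by simp
  then have "(step P ^^ length ?c) ?s = fold exec ?c ?s"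
    by (rule funpow_step_straight) simp
  also have "\<dots> = ?init"
    using r by simp
  finally have s0: "(step P ^^ 3) ?s = ?init"
    by (simp add: numeral_3_eq_3)
  have loop: "\<exists>s'. (step P ^^ T k) s = s' \<and> pc s' = ?p \<and> represents s' (iter ?f k st) \<and>
      reg s' (cap d) = ?b \<and> reg s' (ctr d) = k \<and> keeps_loops d s s'" if "k \<le> ?b" for k
    using that
  proof (induction k)
    case 0
    have "represents ?init st"
      using represents_same_but_tmp[OF For.prems(2) r(3)] by (simp add: represents_def)
    moreover have "keeps_loops d s ?init"
      using same_but_tmpD[OF r(3)] by (simp add: keeps_loops_def)
    moreover have "(step P ^^ T 0) s = ?init"
      using r(1) s0 by (simp add: T_def funpow_add_apply)
    ultimately show ?case
      by (simp add: T_def)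
  next
    case (Suc k)
    from Suc.prems have "k \<le> ?b"
      by simp
    from Suc.IH[OF this] obtain s' where s': "(step P ^^ T k) s = s'" "pc s' = ?p"
      "represents s' (iter ?f k st)" "reg s' (cap d) = ?b" "reg s' (ctr d) = k"
      "keeps_loops d s s'"
      by blast
    let ?s1 = "s'\<lparr>pc := ?p + 1, reg := (reg s')(tmp 0 := ?b - k)\<rparr>"
    let ?s2 = "s'\<lparr>pc := ?p + 4, reg := (reg s')(tmp 0 := ?b - k)\<rparr>"
    let ?s3 = "s'\<lparr>pc := ?p + 6, reg := (reg s')(tmp 0 := 0, vreg x := k)\<rparr>"
    have "step P s' = exec (Sub (tmp 0) (cap d) (ctr d)) s'"
      using For.prems s'(2) by (intro step_exec) (simp add: numeral_eq_Suc)
    then have 1: "step P s' = ?s1"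
      using s' by simp
    have "step P ?s1 = exec (JumpPos (tmp 0) (pc s + exp_size e + 7)) ?s1"
      using For.prems s'(2) by (intro step_exec) (simp add: numeral_eq_Suc)
    then have 2: "step P ?s1 = ?s2"
      using Suc.prems by simp
    have "(step P ^^ length [Const (tmp 0) 0, Add (vreg x) (ctr d) (tmp 0)]) ?s2 =
        fold exec [Const (tmp 0) 0, Add (vreg x) (ctr d) (tmp 0)] ?s2"
      using For.prems s'(2) by (intro funpow_step_straight) (auto simp: numeral_eq_Suc)
    also have "\<dots> = ?s3"
      using s' by simp
    finally have 3: "(step P ^^ 2) ?s2 = ?s3"
      by (simp add: numeral_2_eq_2)
    have "represents ?s3 (set_var x k (iter ?f k st))"
      using s'(3) by (simp add: represents_def)
    moreover have "code_at P (pc ?s3) (compile c (pc ?s3) (d + 1))"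
      using For.prems by (simp add: numeral_eq_Suc algebra_simps)
    ultimately obtain s4 where
      s4: "(step P ^^ time c (set_var x k (iter ?f k st))) ?s3 = s4" "pc s4 = pc ?s3 + cmd_size c"
      "represents s4 (?f k (iter ?f k st))" "keeps_loops (d+1) ?s3 s4"
      using For.IH by blast
    have ctr: "reg s4 (ctr d) = k" "reg s4 (cap d) = ?b"
      using s4(4) s' by (simp_all add: keeps_loops_def)
    let ?s6 = "s4\<lparr>pc := pc s4 + 2, reg := (reg s4)(tmp 0 := 1, ctr d := Suc k)\<rparr>"
    let ?s7 = "s4\<lparr>pc := ?p, reg := (reg s4)(tmp 0 := 1, ctr d := Suc k)\<rparr>"
    have "(step P ^^ length [Const (tmp 0) 1, Add (ctr d) (ctr d) (tmp 0)]) s4 =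
        fold exec [Const (tmp 0) 1, Add (ctr d) (ctr d) (tmp 0)] s4"
      using For.prems s4(2) by (intro funpow_step_straight) (auto simp: numeral_eq_Suc algebra_simps)
    also have "\<dots> = ?s6"
      using ctr by simp
    finally have 5: "(step P ^^ 2) s4 = ?s6"
      by (simp add: numeral_2_eq_2)
    have "step P ?s6 = exec (JumpPos (tmp 0) ?p) ?s6"
      using For.prems s4(2) by (intro step_exec) (simp add: numeral_eq_Suc algebra_simps)
    then have 6: "step P ?s6 = ?s7"
      by simp
    have "T (Suc k) =
        T k + (1 + (1 + (2 + (time c (set_var x k (iter ?f k st)) + (2 + 1)))))"
      by (simp add: T_def)
    then have "(step P ^^ T (Suc k)) s = ?s7"
      by (simp only: funpow_add_apply s'(1) funpow_1_apply 1 2 3 s4(1) 5 6)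
    moreover have "represents ?s7 (iter ?f (Suc k) st)"
      using s4(3) by (simp add: represents_def)
    moreover have "keeps_loops d s ?s7"
      using s'(6) s4(4) by (simp add: keeps_loops_def)
    moreover have "reg ?s7 (cap d) = ?b" "reg ?s7 (ctr d) = Suc k"
      using ctr by simp_all
    ultimately show ?case
      by (simp del: fun_upd_apply)
  qed
  then obtain s' where s': "(step P ^^ T ?b) s = s'" "pc s' = ?p"
    "represents s' (iter ?f ?b st)" "reg s' (cap d) = ?b" "reg s' (ctr d) = ?b"
    "keeps_loops d s s'"
    by blast
  let ?s1 = "s'\<lparr>pc := ?p + 1, reg := (reg s')(tmp 0 := 0)\<rparr>"
  let ?s2 = "s'\<lparr>pc := ?p + 2, reg := (reg s')(tmp 0 := 0)\<rparr>"
  let ?s3 = "s'\<lparr>pc := ?p + 3, reg := (reg s')(tmp 0 := 1)\<rparr>"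
  let ?s4 = "s'\<lparr>pc := pc s + cmd_size (For x e c), reg := (reg s')(tmp 0 := 1)\<rparr>"
  have "step P s' = exec (Sub (tmp 0) (cap d) (ctr d)) s'"
    using For.prems s'(2) by (intro step_exec) (simp add: numeral_eq_Suc)
  then have 1: "step P s' = ?s1"
    using s' by simp
  have "step P ?s1 = exec (JumpPos (tmp 0) (pc s + exp_size e + 7)) ?s1"
    using For.prems s'(2) by (intro step_exec) (simp add: numeral_eq_Suc)
  then have 2: "step P ?s1 = ?s2"
    by simp
  have "step P ?s2 = exec (Const (tmp 0) 1) ?s2"
    using For.prems s'(2) by (intro step_exec) (simp add: numeral_eq_Suc)
  then have 3: "step P ?s2 = ?s3"
    by simp
  have "step P ?s3 = exec (JumpPos (tmp 0) (pc s + cmd_size (For x e c))) ?s3"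
    using For.prems s'(2) by (intro step_exec) (simp add: numeral_eq_Suc algebra_simps)
  then have 4: "step P ?s3 = ?s4"
    by simp
  have "time (For x e c) st = T ?b + (1 + (1 + (1 + 1)))"
    by (simp add: T_def)
  then have "(step P ^^ time (For x e c) st) s = ?s4"
    by (simp only: funpow_add_apply s'(1) funpow_1_apply 1 2 3 4)
  moreover have "represents ?s4 (run (For x e c) st)"
    using s'(3) by (simp add: represents_def)
  moreover have "keeps_loops d s ?s4"
    using s'(6) by (simp add: keeps_loops_def)
  ultimately show ?case
    by simp
next
  case (Input x)
  then have "step P s = exec (Read (vreg x)) s"
    by (intro step_exec) simp
  with Input.prems show ?case
    by (auto simp: represents_def keeps_loops_def split: list.splits)
next
  case (Output e)
  have "code_at P (pc s) (comp_exp e 0)"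
    using Output.prems by simp
  from comp_exp_steps[OF Output.prems(2) this] obtain r where
    r: "(step P ^^ exp_size e) s = s\<lparr>pc := pc s + exp_size e, reg := r\<rparr>"
    "r (tmp 0) = eval e st" "same_but_tmp 0 (reg s) r" by blast
  let ?s = "s\<lparr>pc := pc s + exp_size e, reg := r\<rparr>"
  let ?s' = "s\<lparr>pc := pc s + exp_size e + 1, reg := r, outp := outp s @ [eval e st]\<rparr>"
  have "step P ?s = exec (Print (tmp 0)) ?s"
    using Output.prems by (intro step_exec) simp
  then have "step P ?s = ?s'"
    using r(2) by simp
  then have "(step P ^^ time (Output e) st) s = ?s'"
    using r(1) by simp
  moreover have "represents ?s' (run (Output e) st)"
    using Output.prems same_but_tmpD[OF r(3)] by (simp add: represents_def)
  moreover have "keeps_loops d s ?s'"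
    using same_but_tmpD[OF r(3)] by (simp add: keeps_loops_def)
  ultimately show ?case
    by simp
qed

definition start :: "nat list \<Rightarrow> state" where
  "start w = \<lparr>vr = (\<lambda>_. 0), ar = (\<lambda>_ _. 0), inq = w, outq = []\<rparr>"

lemma funpow_step_halted: "halted P s \<Longrightarrow> (step P ^^ t) s = s"
  by (induction t) (simp_all add: step_def)

text \<open>A halted configuration is never left, so here, for a whole program, the exact count may
  be weakened to an upper bound.\<close>

corollary computes_within_compile:
  assumes "time c (start w) \<le> t"
  shows "computes_within (compile c 0 0) w t (outq (run c (start w)))"
proof -
  let ?P = "compile c 0 0" and ?s = "initial w"
  have "represents ?s (start w)"
    by (simp add: represents_def initial_def start_def)
  moreover have "code_at ?P (pc ?s) (compile c (pc ?s) 0)"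
    by (simp add: code_at_def initial_def)
  ultimately obtain s' where s': "(step ?P ^^ time c (start w)) ?s = s'" "pc s' = cmd_size c"
    "represents s' (run c (start w))"
    using compile_correct[of ?P ?s c 0 "start w"] by (auto simp: initial_def)
  then have "halted ?P s'"
    by (simp add: halted_def)
  moreover have "(step ?P ^^ t) ?s = s'"
    using assms s'(1) funpow_step_halted[OF \<open>halted ?P s'\<close>]
    by (metis funpow_add_apply le_add_diff_inverse)
  ultimately show ?thesis
    using s'(3) by (simp add: computes_within_def represents_def)
qed

subsection \<open>Loops with bounds that are known in advance\<close>

lemma iter_invariant:
  assumes "I 0 s" "\<And>i s. i < n \<Longrightarrow> I i s \<Longrightarrow> I (Suc i) (f i s)"
  shows "I n (iter f n s)"
proof -
  have "I k (iter f k s)" if "k \<le> n" for k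
    using that by (induction k) (simp_all add: assms)
  then show ?thesis
    by simp
qed

lemma run_For_invariant:
  assumes "eval e s = n" "I 0 s" "\<And>i s. i < n \<Longrightarrow> I i s \<Longrightarrow> I (Suc i) (run c (set_var x i s))"
  shows "I n (run (For x e c) s)"
  using assms by (auto intro: iter_invariant)

section \<open>Frame conditions: what a command leaves unchanged\<close>

primrec assigned :: "cmd \<Rightarrow> var set" where
  "assigned Skip = {}"
| "assigned (Assign x e) = {x}"
| "assigned (Write a e f) = {}"
| "assigned (c ;; d) = assigned c \<union> assigned d"
| "assigned (Cond e c d) = assigned c \<union> assigned d"
| "assigned (For x e c) = insert x (assigned c)"
| "assigned (Input x) = {x}"
| "assigned (Output e) = {}"

primrec written :: "cmd \<Rightarrow> array set" where
  "written Skip = {}"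
| "written (Assign x e) = {}"
| "written (Write a e f) = {a}"
| "written (c ;; d) = written c \<union> written d"
| "written (Cond e c d) = written c \<union> written d"
| "written (For x e c) = written c"
| "written (Input x) = {}"
| "written (Output e) = {}"

primrec silent :: "cmd \<Rightarrow> bool" where
  "silent Skip \<longleftrightarrow> True"
| "silent (Assign x e) \<longleftrightarrow> True"
| "silent (Write a e f) \<longleftrightarrow> True"
| "silent (c ;; d) \<longleftrightarrow> silent c \<and> silent d"
| "silent (Cond e c d) \<longleftrightarrow> silent c \<and> silent d"
| "silent (For x e c) \<longleftrightarrow> silent c"
| "silent (Input x) \<longleftrightarrow> True"
| "silent (Output e) \<longleftrightarrow> False"

lemma vr_run: "x \<notin> assigned c \<Longrightarrow> vr (run c s) x = vr s x"
proof (induction c arbitrary: s)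
  case (For y e c)
  then show ?case
    by (intro run_For_invariant[where I = "\<lambda>i s'. vr s' x = vr s x"]) auto
qed auto

lemma ar_run: "a \<notin> written c \<Longrightarrow> ar (run c s) a = ar s a"
proof (induction c arbitrary: s)
  case (For y e c)
  then show ?case
    by (intro run_For_invariant[where I = "\<lambda>i s'. ar s' a = ar s a"]) auto
qed auto

lemma outq_run: "silent c \<Longrightarrow> outq (run c s) = outq s"
proof (induction c arbitrary: s)
  case (For y e c)
  then show ?case
    by (intro run_For_invariant[where I = "\<lambda>i s'. outq s' = outq s"]) auto
qed auto

section \<open>Polynomial time bounds read off from the syntax\<close>

primrec fixed :: "exp \<Rightarrow> bool" where
  "fixed (Num k) \<longleftrightarrow> True"
| "fixed (Var x) \<longleftrightarrow> x = Bound"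
| "fixed (Arr a e) \<longleftrightarrow> False"
| "fixed (Plus e f) \<longleftrightarrow> False"
| "fixed (Minus e f) \<longleftrightarrow> fixed e"

primrec exp_poly :: "exp \<Rightarrow> nat poly" where
  "exp_poly (Num k) = [:k:]"
| "exp_poly (Var x) = [:0, 1:]"
| "exp_poly (Arr a e) = 0"
| "exp_poly (Plus e f) = 0"
| "exp_poly (Minus e f) = exp_poly e"

text \<open>A truncated difference is at most its minuend, so nothing has to be known about the
  subtrahend. This is how \<open>capped\<close> can carry an arbitrary expression and still be
  \<open>fixed\<close>.\<close>

lemma eval_le_poly: "fixed e \<Longrightarrow> eval e s \<le> poly (exp_poly e) (vr s Bound)"
proof (induction e)
  case (Minus e f)
  then show ?case by (simp add: le_diff_conv trans_le_add1)
qed auto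

primrec fixed_bounds :: "cmd \<Rightarrow> bool" where
  "fixed_bounds Skip \<longleftrightarrow> True"
| "fixed_bounds (Assign x e) \<longleftrightarrow> True"
| "fixed_bounds (Write a e f) \<longleftrightarrow> True"
| "fixed_bounds (c ;; d) \<longleftrightarrow> fixed_bounds c \<and> fixed_bounds d"
| "fixed_bounds (Cond e c d) \<longleftrightarrow> fixed_bounds c \<and> fixed_bounds d"
| "fixed_bounds (For x e c) \<longleftrightarrow> fixed e \<and> fixed_bounds c"
| "fixed_bounds (Input x) \<longleftrightarrow> True"
| "fixed_bounds (Output e) \<longleftrightarrow> True"

text \<open>The branches of a conditional are added because a maximum of polynomials need not be a
  polynomial.\<close>

primrec time_poly :: "cmd \<Rightarrow> nat poly" where
  "time_poly Skip = 0"
| "time_poly (Assign x e) = [:exp_size e + 2:]"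
| "time_poly (Write a e f) = [:exp_size e + exp_size f + 7:]"
| "time_poly (c ;; d) = time_poly c + time_poly d"
| "time_poly (Cond e c d) = [:exp_size e + 3:] + time_poly c + time_poly d"
| "time_poly (For x e c) = [:exp_size e + 7:] + exp_poly e * ([:7:] + time_poly c)"
| "time_poly (Input x) = [:1:]"
| "time_poly (Output e) = [:exp_size e + 1:]"

text \<open>As \<open>Bound\<close> is never assigned, the bounds of inner loops, evaluated in
  intermediate states, still refer to its initial value.\<close>

lemma time_le_poly:
  assumes "fixed_bounds c" "Bound \<notin> assigned c"
  shows "time c s \<le> poly (time_poly c) (vr s Bound)"
  using assms
proof (induction c arbitrary: s)
  case (Seq c d)
  have "time d (run c s) \<le> poly (time_poly d) (vr (run c s) Bound)"
    "time c s \<le> poly (time_poly c) (vr s Bound)" "vr (run c s) Bound = vr s Bound"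
    using Seq.prems Seq.IH(1)[of s] Seq.IH(2)[of "run c s"] by (simp_all add: vr_run)
  then show ?case
    by simp
next
  case (Cond e c d)
  have "time c s \<le> poly (time_poly c) (vr s Bound)" "time d s \<le> poly (time_poly d) (vr s Bound)"
    using Cond.prems Cond.IH[of s] by simp_all
  then show ?case
    by auto
next
  case (For x e c)
  let ?f = "\<lambda>i s. run c (set_var x i s)"
  have "vr (iter ?f i s) Bound = vr s Bound" for i
    using For.prems by (intro iter_invariant[where I = "\<lambda>i s'. vr s' Bound = vr s Bound"])
      (auto simp: vr_run)
  then have "time c (set_var x i (iter ?f i s)) \<le> poly (time_poly c) (vr s Bound)" for i
    using For.IH[of "set_var x i (iter ?f i s)"] For.prems by simp
  then have "(\<Sum>i<eval e s. 7 + time c (set_var x i (iter ?f i s)))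
      \<le> (\<Sum>i<eval e s. 7 + poly (time_poly c) (vr s Bound))"
    by (intro sum_mono add_left_mono)
  also have "\<dots> = eval e s * (7 + poly (time_poly c) (vr s Bound))"
    by simp
  also have "\<dots> \<le> poly (exp_poly e) (vr s Bound) * (7 + poly (time_poly c) (vr s Bound))"
    using For.prems by (intro mult_right_mono eval_le_poly) auto
  finally show ?case
    by simp
qed auto

lemma poly_mono_nat: "x \<le> y \<Longrightarrow> poly p x \<le> poly p (y :: nat)"
  by (induction p) (auto intro!: add_mono mult_mono)

section \<open>Scheduling around fixed successors\<close>

lemma card_fibres:
  assumes "finite J" "finite A"
  shows "card {j \<in> J. f j \<in> A} = (\<Sum>t\<in>A. card {j \<in> J. f j = t})"
proof -
  have "{j \<in> J. f j \<in> A} = (\<Union>t\<in>A. {j \<in> J. f j = t})"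
    by auto
  also have "card \<dots> = (\<Sum>t\<in>A. card {j \<in> J. f j = t})"
    using assms by (intro card_UN_disjoint) auto
  finally show ?thesis .
qed

lemma card_fibre_upd:
  assumes "finite J" "j \<in> J" "f j \<noteq> t"
  shows "card {k \<in> J. (f(j := p)) k = t} = card {k \<in> J. f k = t} + (if t = p then 1 else 0)"
proof -
  have "{k \<in> J. (f(j := p)) k = t} =
      (if t = p then insert j {k \<in> J. f k = t} else {k \<in> J. f k = t})"
    using assms by auto
  moreover have "finite {k \<in> J. f k = t}" "j \<notin> {k \<in> J. f k = t}"
    using assms by auto
  ultimately show ?thesis
    by (cases "t = p") simp_all
qed

text \<open>The successors \<open>S\<close> are fixed at their times in the schedule \<open>T\<close>; \<open>D\<close> bounds the times
  of all jobs strictly from above.\<close>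

locale fixed_successors =
  fixes n m N :: nat and S :: "nat set" and D T :: "nat \<Rightarrow> nat"
  assumes S_jobs: "S \<subseteq> {1..n}"
    and T_pos: "\<And>j. j \<in> {1..n} \<Longrightarrow> 1 \<le> T j"
    and T_load: "\<And>t. card {j \<in> {1..n}. T j = t} \<le> m"
    and T_due: "\<And>j. j \<in> {1..n} \<Longrightarrow> T j < D j"
    and due_less: "\<And>j. j \<in> {1..n} \<Longrightarrow> D j < N"
begin

text \<open>\<open>C j = 0\<close> means that job \<open>j\<close> is not scheduled yet. The jobs with due date below \<open>d\<close>, and
  those among \<open>{1..i}\<close> with due date \<open>d\<close>, have been processed.\<close>

definition edf_inv :: "nat \<Rightarrow> nat \<Rightarrow> (nat \<Rightarrow> nat) \<Rightarrow> (nat \<Rightarrow> nat) \<Rightarrow> bool" where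
  "edf_inv d i C L \<longleftrightarrow>
     (\<forall>t. 1 \<le> t \<and> t < N \<longrightarrow> L t = card {j \<in> {1..n}. C j = t} \<and> L t \<le> m) \<and>
     (\<forall>j\<in>S. C j = T j) \<and>
     (\<forall>j\<in>{1..n} - S. C j \<noteq> 0 \<longrightarrow> C j < D j \<and> D j \<le> d \<and> (\<forall>t. 1 \<le> t \<and> t < C j \<longrightarrow> L t = m)) \<and>
     (\<forall>j\<in>{1..n} - S. D j < d \<or> D j = d \<and> j \<le> i \<longrightarrow> C j \<noteq> 0)"

lemma edf_invD:
  assumes "edf_inv d i C L"
  shows "1 \<le> t \<Longrightarrow> t < N \<Longrightarrow> card {j \<in> {1..n}. C j = t} = L t"
    and "1 \<le> t \<Longrightarrow> t < N \<Longrightarrow> L t \<le> m"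
    and "j \<in> S \<Longrightarrow> C j = T j"
    and "j \<in> {1..n} \<Longrightarrow> j \<notin> S \<Longrightarrow> C j \<noteq> 0 \<Longrightarrow> C j < D j"
    and "j \<in> {1..n} \<Longrightarrow> j \<notin> S \<Longrightarrow> C j \<noteq> 0 \<Longrightarrow> D j \<le> d"
    and "j \<in> {1..n} \<Longrightarrow> j \<notin> S \<Longrightarrow> 1 \<le> t \<Longrightarrow> t < C j \<Longrightarrow> L t = m"
    and "j \<in> {1..n} \<Longrightarrow> j \<notin> S \<Longrightarrow> D j < d \<or> D j = d \<and> j \<le> i \<Longrightarrow> C j \<noteq> 0"
  by (use assms[unfolded edf_inv_def] in \<open>simp; fail | force\<close>)+

lemma edf_inv_skip:
  assumes "edf_inv d i C L" "C (Suc i) \<noteq> 0 \<or> d < D (Suc i)"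
  shows "edf_inv d (Suc i) C L"
  using assms unfolding edf_inv_def by (auto simp: le_Suc_eq)

text \<open>After a pass over all \<open>n\<close> jobs, the restriction to indices at most
  \<open>i = n\<close> is void, so due date \<open>d\<close> joins the due dates that are completely
  processed.\<close>

lemma edf_inv_next:
  assumes "edf_inv d n C L"
  shows "edf_inv (Suc d) 0 C L"
  using assms unfolding edf_inv_def by (auto simp: less_Suc_eq le_Suc_eq)

lemma edf_slot_before_due:
  assumes inv: "edf_inv d i C L" and j: "j \<in> {1..n}" "j \<notin> S" "C j = 0" and due: "D j = d"
  shows "\<exists>t. 1 \<le> t \<and> t < D j \<and> L t < m"
proof (rule ccontr)
  assume "\<nexists>t. 1 \<le> t \<and> t < D j \<and> L t < m"
  moreover have "D j < N"
    using due_less j by blast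
  ultimately have L: "card {k \<in> {1..n}. C k = t} = m" if "t \<in> {1..<D j}" for t
    using that edf_invD(1,2)[OF inv, of t] by force
  let ?A = "{k \<in> {1..n}. C k \<in> {1..<D j}}"
  \<comment> \<open>A successor in \<open>?A\<close> has the same time in \<open>T\<close>. Any
    other job there has been placed already, hence is due by \<open>d = D j\<close>, and
    \<open>T\<close> meets its due date.\<close>
  have "T k < D j" if "k \<in> ?A" for k
  proof (cases "k \<in> S")
    case True
    with that edf_invD(3)[OF inv] show ?thesis
      by auto
  next
    case False
    then have "D k \<le> d"
      using that edf_invD(5)[OF inv, of k] by auto
    with T_due[of k] that due show ?thesis
      by auto
  qed
  \<comment> \<open>The contradiction: \<open>j\<close> itself is one more job that \<open>T\<close>
    completes before \<open>D j\<close>, while the slots before \<open>D j\<close> are filled by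
    \<open>?A\<close> alone, which misses \<open>j\<close> because \<open>C j = 0\<close>.\<close>
  then have "insert j ?A \<subseteq> {k \<in> {1..n}. T k \<in> {1..<D j}}"
    using j T_due[of j] T_pos by auto
  then have "card (insert j ?A) \<le> card {k \<in> {1..n}. T k \<in> {1..<D j}}"
    by (intro card_mono) auto
  also have "\<dots> = (\<Sum>t\<in>{1..<D j}. card {k \<in> {1..n}. T k = t})"
    by (rule card_fibres) auto
  also have "\<dots> \<le> (\<Sum>t\<in>{1..<D j}. m)"
    by (intro sum_mono T_load)
  also have "\<dots> = (\<Sum>t\<in>{1..<D j}. card {k \<in> {1..n}. C k = t})"
    using L by (intro sum.cong) auto
  also have "\<dots> = card ?A"
    by (rule card_fibres[symmetric]) auto
  finally have "card (insert j ?A) \<le> card ?A" .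
  moreover have "finite ?A" "j \<notin> ?A"
    using j by auto
  ultimately show False
    by simp
qed

lemma edf_inv_place:
  assumes inv: "edf_inv d i C L" and i: "i < n" "C (Suc i) = 0" "D (Suc i) \<le> d"
    and first: "p = 0 \<longrightarrow> (\<forall>t. 1 \<le> t \<and> t < N \<longrightarrow> m \<le> L t)"
      "p \<noteq> 0 \<longrightarrow> p < N \<and> L p < m \<and> (\<forall>t. 1 \<le> t \<and> t < p \<longrightarrow> m \<le> L t)"
  shows "edf_inv d (Suc i) (C(Suc i := p)) (L(p := L p + 1))"
proof -
  let ?j = "Suc i"
  have j: "?j \<in> {1..n}" "?j \<notin> S"
    using i edf_invD(3)[OF inv, of ?j] T_pos[of ?j] by auto
  \<comment> \<open>Had the job been due before \<open>d\<close>, the invariant would have it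
    scheduled already.\<close>
  then have due: "D ?j = d"
    using i edf_invD(7)[OF inv, of ?j] by force
  obtain t where t: "1 \<le> t" "t < D ?j" "L t < m"
    using edf_slot_before_due[OF inv j i(2) due] by blast
  have "D ?j < N"
    using due_less j by blast
  \<comment> \<open>The free slot \<open>t\<close> before the due date excludes
    \<open>p = 0\<close>, which would mean that all slots are full; since all slots before
    \<open>p\<close> are full, also \<open>p \<le> t\<close>.\<close>
  have p: "p \<noteq> 0" "p < N" "L p < m" "p < D ?j" "\<forall>t. 1 \<le> t \<and> t < p \<longrightarrow> m \<le> L t"
    using t first \<open>D ?j < N\<close> by (meson dual_order.strict_trans leD leI order.strict_trans1)+
  have count: "card {k \<in> {1..n}. (C(?j := p)) k = t} =
      card {k \<in> {1..n}. C k = t} + (if t = p then 1 else 0)" if "1 \<le> t" for t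
    using that i j by (intro card_fibre_upd) auto
  have full: "L t = m" if "1 \<le> t" "t < p" for t
    using that p(2,5) edf_invD(2)[OF inv, of t] by (simp add: le_antisym)
  have "(L(p := L p + 1)) t = card {k \<in> {1..n}. (C(?j := p)) k = t} \<and> (L(p := L p + 1)) t \<le> m"
    if "1 \<le> t \<and> t < N" for t
    using that p(3) count[of t] edf_invD(1,2)[OF inv, of t] by simp
  moreover have "\<forall>k\<in>S. (C(?j := p)) k = T k"
    using j edf_invD(3)[OF inv] by auto
  moreover have "(C(?j := p)) k < D k \<and> D k \<le> d \<and>
      (\<forall>t. 1 \<le> t \<and> t < (C(?j := p)) k \<longrightarrow> (L(p := L p + 1)) t = m)"
    if k: "k \<in> {1..n} - S" "(C(?j := p)) k \<noteq> 0" for k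
  proof (cases "k = ?j")
    case True
    with p full i show ?thesis
      by auto
  next
    case False
    then have "C k \<noteq> 0" "k \<in> {1..n}" "k \<notin> S"
      using k by auto
    moreover from this have "C k < D k" "D k \<le> d" "\<And>t. 1 \<le> t \<Longrightarrow> t < C k \<Longrightarrow> L t = m"
      using edf_invD(4-6)[OF inv, of k] by blast+
    ultimately show ?thesis
      using False p(3) by auto
  qed
  moreover have "(C(?j := p)) k \<noteq> 0"
    if "k \<in> {1..n} - S" "D k < d \<or> D k = d \<and> k \<le> ?j" for k
    using that p(1) edf_invD(7)[OF inv, of k] by (cases "k = ?j") (auto simp: le_Suc_eq)
  ultimately show ?thesis
    unfolding edf_inv_def by blast
qed

context
  fixes C L assumes inv: "edf_inv N 0 C L"
begin

text \<open>All due dates lie below \<open>N\<close>, so the invariant at \<open>d = N\<close>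
  leaves no job unscheduled.\<close>

lemma edf_pos: "j \<in> {1..n} \<Longrightarrow> 1 \<le> C j"
  using edf_invD(3,7)[OF inv, of j] due_less[of j] T_pos[of j] by (cases "j \<in> S") (auto simp: Suc_le_eq)

lemma edf_less_due: "j \<in> {1..n} \<Longrightarrow> C j < D j"
  using edf_invD(3,4)[OF inv, of j] edf_pos[of j] T_due[of j] by (cases "j \<in> S") auto

text \<open>If a job outside \<open>S\<close> completes after \<open>t\<close>, then all slots up to
  \<open>t\<close> hold \<open>m\<close> jobs, which \<open>T\<close> cannot exceed. Otherwise only
  jobs of \<open>S\<close> complete after \<open>t\<close>, and they have the same times in
  \<open>T\<close>.\<close>

lemma edf_dominates: "card {j \<in> {1..n}. t < C j} \<le> card {j \<in> {1..n}. t < T j}"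
proof -
  have split: "card {j \<in> {1..n}. t < f j} + card {j \<in> {1..n}. f j \<in> {1..t}} = n"
    if "\<And>j. j \<in> {1..n} \<Longrightarrow> 1 \<le> f j" for f :: "nat \<Rightarrow> nat"
  proof -
    have "card {j \<in> {1..n}. t < f j} + card {j \<in> {1..n}. f j \<in> {1..t}} =
        card ({j \<in> {1..n}. t < f j} \<union> {j \<in> {1..n}. f j \<in> {1..t}})"
      by (intro card_Un_disjoint[symmetric]) auto
    also have "{j \<in> {1..n}. t < f j} \<union> {j \<in> {1..n}. f j \<in> {1..t}} = {1..n}"
      using that by fastforce
    finally show ?thesis
      by simp
  qed
  show ?thesis
  proof (cases "\<exists>j\<in>{1..n} - S. t < C j")
    case True
    then obtain j where j: "j \<in> {1..n} - S" "t < C j"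
      by blast
    have "C j < N"
      using edf_less_due[of j] due_less[of j] j by simp
    then have "card {k \<in> {1..n}. C k = t'} = m" if "t' \<in> {1..t}" for t'
      using that j edf_invD(1)[OF inv, of t'] edf_invD(6)[OF inv, of j t'] by auto
    then have "(\<Sum>t'\<in>{1..t}. card {k \<in> {1..n}. C k = t'}) = (\<Sum>t'\<in>{1..t}. m)"
      by (intro sum.cong) auto
    moreover have "(\<Sum>t'\<in>{1..t}. card {k \<in> {1..n}. T k = t'}) \<le> (\<Sum>t'\<in>{1..t}. m)"
      by (intro sum_mono T_load)
    ultimately have "card {j \<in> {1..n}. T j \<in> {1..t}} \<le> card {j \<in> {1..n}. C j \<in> {1..t}}"
      by (simp only: card_fibres finite_atLeastAtMost)
    then show ?thesis
      using split[of C, OF edf_pos] split[of T, OF T_pos] by linarith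
  next
    case False
    then have "{j \<in> {1..n}. t < C j} \<subseteq> {j \<in> {1..n}. t < T j}"
      using edf_invD(3)[OF inv] by (metis (mono_tags, lifting) Collect_mono DiffI)
    then show ?thesis
      by (intro card_mono) auto
  qed
qed

end

end

section \<open>Comparing schedules\<close>

text \<open>Tail-sum formula: write \<open>f j\<close> as the number of \<open>t\<close> below it
  and exchange the two summations.\<close>

lemma sum_eq_sum_card_less:
  assumes "finite J" "\<And>j. j \<in> J \<Longrightarrow> f j \<le> B"
  shows "(\<Sum>j\<in>J. f j) = (\<Sum>t<B. card {j \<in> J. t < (f j :: nat)})"
proof -
  have "f j = (\<Sum>t<B. if t < f j then 1 else 0)" if "j \<in> J" for j
  proof -
    have "{t \<in> {..<B}. t < f j} = {..<f j}"
      using assms(2)[OF that] by auto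
    then have "card {t \<in> {..<B}. t < f j} = f j"
      by simp
    then show ?thesis
      by (simp add: sum.If_cases Int_def)
  qed
  then have "(\<Sum>j\<in>J. f j) = (\<Sum>j\<in>J. \<Sum>t<B. if t < f j then 1 else 0)"
    by (rule sum.cong[OF refl])
  also have "\<dots> = (\<Sum>t<B. \<Sum>j\<in>J. if t < f j then 1 else 0)"
    by (rule sum.swap)
  also have "\<dots> = (\<Sum>t<B. card {j \<in> J. t < f j})"
    using assms(1) by (simp add: sum.If_cases Int_def)
  finally show ?thesis .
qed

text \<open>Both objectives depend only on the numbers of jobs completed after each
  \<open>t\<close>: the makespan is the first \<open>t\<close> after which none is left, and the sum
  is given by the tail-sum formula. Thus one comparison serves both.\<close>

lemma cost_mono_if_dominated:
  assumes n: "num_jobs I \<ge> 1"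
    and dom: "\<And>t. card {j \<in> jobs I. t < C j} \<le> card {j \<in> jobs I. t < T j}"
  shows "cost \<gamma> I C \<le> cost \<gamma> I T"
proof (cases \<gamma>)
  case Makespan
  have fin: "finite (jobs I)" and ne: "jobs I \<noteq> {}"
    using n by (auto simp: jobs_def)
  let ?M = "Max (T ` jobs I)"
  have "{j \<in> jobs I. ?M < T j} = {}"
    using fin by (auto simp: not_less)
  then have "card {j \<in> jobs I. ?M < C j} = 0"
    using dom[of ?M] by (simp only: card.empty)
  then have "{j \<in> jobs I. ?M < C j} = {}"
    using fin by simp
  then have "C j \<le> ?M" if "j \<in> jobs I" for j
    using that not_less by blast
  with fin ne Makespan show ?thesis
    by simp
next
  case Sum_Completion
  have fin: "finite (jobs I)"
    by (simp add: jobs_def)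
  let ?B = "Max (C ` jobs I) + Max (T ` jobs I)"
  have B: "C j \<le> ?B" "T j \<le> ?B" if "j \<in> jobs I" for j
    using fin that by (simp_all add: trans_le_add1 trans_le_add2)
  have "(\<Sum>j\<in>jobs I. C j) \<le> (\<Sum>j\<in>jobs I. T j)"
    using sum_eq_sum_card_less[OF fin B(1)] sum_eq_sum_card_less[OF fin B(2)]
      sum_mono[of "{..<?B}", OF dom] by simp
  with Sum_Completion show ?thesis
    by simp
qed

lemma cost_mono:
  assumes "num_jobs I \<ge> 1" "\<And>j. j \<in> jobs I \<Longrightarrow> C j \<le> T j"
  shows "cost \<gamma> I C \<le> cost \<gamma> I T"
proof (rule cost_mono_if_dominated[OF assms(1)])
  fix t
  have "{j \<in> jobs I. t < C j} \<subseteq> {j \<in> jobs I. t < T j}"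
    using assms(2) less_le_trans by blast
  then show "card {j \<in> jobs I. t < C j} \<le> card {j \<in> jobs I. t < T j}"
    by (intro card_mono) (auto simp: jobs_def)
qed

text \<open>Each completion time is replaced by its rank among the times in use. This keeps the
  strict order of the jobs and the groups of simultaneous jobs, removes idle times, and delays no
  job because times start at 1.\<close>

lemma compressed_schedule:
  assumes inst: "I \<in> instances" and feas: "feasible I C"
  shows "\<exists>T. feasible I T \<and> (\<forall>j\<in>jobs I. T j \<le> num_jobs I) \<and> cost \<gamma> I T \<le> cost \<gamma> I C"
proof -
  define T where "T j = card {t \<in> C ` jobs I. t \<le> C j}" for j
  have fin: "finite (C ` jobs I)"
    by (simp add: jobs_def)
  have pos: "1 \<le> C j" if "j \<in> jobs I" for j
    using feas that by (auto simp: feasible_def is_schedule_def)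
  have strict: "T i < T j" if "i \<in> jobs I" "j \<in> jobs I" "C i < C j" for i j
    unfolding T_def
  proof (rule psubset_card_mono)
    show "finite {t \<in> C ` jobs I. t \<le> C j}"
      using fin by simp
    have "C j \<in> {t \<in> C ` jobs I. t \<le> C j}" "C j \<notin> {t \<in> C ` jobs I. t \<le> C i}"
      using that by simp_all
    moreover have "{t \<in> C ` jobs I. t \<le> C i} \<subseteq> {t \<in> C ` jobs I. t \<le> C j}"
      using that by auto
    ultimately show "{t \<in> C ` jobs I. t \<le> C i} \<subset> {t \<in> C ` jobs I. t \<le> C j}"
      by blast
  qed
  have T_pos: "1 \<le> T j" if "j \<in> jobs I" for j
  proof -
    have "{t \<in> C ` jobs I. t \<le> C j} \<noteq> {}"
      using that by auto
    then show ?thesis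
      using fin by (simp add: T_def Suc_le_eq card_gt_0_iff)
  qed
  have "T j \<le> card (C ` jobs I)" for j
    unfolding T_def using fin by (intro card_mono) auto
  also have "card (C ` jobs I) \<le> num_jobs I"
    using card_image_le[of "jobs I" C] by (simp add: jobs_def)
  finally have T_le: "T j \<le> num_jobs I" for j .
  have T_le_C: "T j \<le> C j" if "j \<in> jobs I" for j
  proof -
    have "{t \<in> C ` jobs I. t \<le> C j} \<subseteq> {1..C j}"
      using pos by auto
    then have "T j \<le> card {1..C j}"
      unfolding T_def by (intro card_mono) auto
    then show ?thesis
      by simp
  qed
  have "card {j \<in> jobs I. T j = t} \<le> machines I" for t
  proof (cases "\<exists>j\<in>jobs I. T j = t")
    case True
    then obtain j where j: "j \<in> jobs I" "T j = t"
      by blast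
    have "{k \<in> jobs I. t = T k} \<subseteq> {k \<in> jobs I. C k = C j}"
    proof safe
      fix k assume "k \<in> jobs I" "t = T k"
      then show "C k = C j"
        using j strict[of k j] strict[of j k] by (metis less_irrefl nat_neq_iff)
    qed
    then have "card {k \<in> jobs I. t = T k} \<le> card {k \<in> jobs I. C k = C j}"
      by (intro card_mono) (simp_all add: jobs_def)
    also have "\<dots> \<le> machines I"
      using feas by (simp add: feasible_def is_schedule_def)
    finally show ?thesis
      by (simp add: eq_commute)
  next
    case False
    then have "{j \<in> jobs I. T j = t} = {}"
      by auto
    then show ?thesis
      by (simp only: card.empty)
  qed
  \<comment> \<open>Literals are jobs by well-formedness, so \<open>strict\<close> applies to
    them.\<close>
  moreover have "sat (\<lambda>i. T i < T j) (constr I j)" if j: "j \<in> jobs I" for j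
  proof -
    have "wf_formula (jobs I) (constr I j)" "sat (\<lambda>i. C i < C j) (constr I j)"
      using inst feas j by (auto simp: instances_def feasible_def)
    then show ?thesis
      using strict[OF _ j] by (cases "constr I j") (auto simp: subset_iff, blast)
  qed
  ultimately have "feasible I T"
    using T_pos by (simp add: feasible_def is_schedule_def)
  moreover have "cost \<gamma> I T \<le> cost \<gamma> I C"
    using inst T_le_C by (intro cost_mono) (simp_all add: instances_def)
  ultimately show ?thesis
    using T_le by blast
qed

section \<open>The algorithm\<close>

abbreviation When :: "exp \<Rightarrow> cmd \<Rightarrow> cmd" where
  "When e c \<equiv> Cond e c Skip"

text \<open>The minimum of a value and \<open>Bound\<close>, in a form accepted by \<^const>\<open>fixed\<close>.\<close>

abbreviation capped :: "exp \<Rightarrow> exp" where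
  "capped e \<equiv> Minus (Var Bound) (Minus (Var Bound) e)"

text \<open>Truncated subtraction serves as a test: the value is positive exactly if the comparison
  holds.\<close>

abbreviation less :: "exp \<Rightarrow> exp \<Rightarrow> exp" where
  "less e f \<equiv> Minus f e"

abbreviation incr :: "exp \<Rightarrow> exp" where
  "incr e \<equiv> Plus e (Num 1)"

subsection \<open>Reading the instance\<close>

definition read_literals :: cmd where
  "read_literals = For Slot (Var LitLen)
     (Input Lit ;; Write Token (Var Ptr) (Var Lit) ;; Assign Ptr (incr (Var Ptr)))"

text \<open>Only the address of the length receives an owner. A nonzero owner therefore marks the
  start of a conjunction, which later tells sensible guesses of addresses from others.\<close>

definition read_clause :: cmd where
  "read_clause = Input LitLen ;; Write Token (Var Ptr) (Var LitLen) ;;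
     Write Owner (Var Ptr) (Var Job) ;; Assign Ptr (incr (Var Ptr)) ;; read_literals"

definition read_formula :: cmd where
  "read_formula = Input Tag ;; Write Succ (Var Job) (Var Tag) ;;
     When (Var Tag) (Input Len ;; For Pos (Var Len) read_clause)"

text \<open>\<open>Bound\<close> exceeds all used addresses, all lengths of conjunctions and all
  times up to the number of jobs. The extra 2 leaves room for the default due date
  \<open>Bound - 1\<close> to be larger than every such time.\<close>

definition read_instance :: cmd where
  "read_instance = Input NumJobs ;; Input Machines ;; Assign Ptr (Num 1) ;;
     For Idx (Var NumJobs) (Assign Job (incr (Var Idx)) ;; read_formula) ;;
     Assign Bound (Plus (Var Ptr) (Plus (Var NumJobs) (Num 2)))"

definition clause_at :: "(nat \<Rightarrow> nat) \<Rightarrow> nat \<Rightarrow> nat list \<Rightarrow> bool" where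
  "clause_at tok p K \<longleftrightarrow> tok p = length K \<and> (\<forall>l<length K. tok (p + 1 + l) = K ! l)"

text \<open>The pairs \<open>(j, K)\<close> of a job and a conjunction of its formula that are in \<open>X\<close> have been
  stored below address \<open>P\<close>. Address 0 serves as an empty conjunction without owner.\<close>

definition layout :: "(nat \<times> nat list) set \<Rightarrow> nat \<Rightarrow> (nat \<Rightarrow> nat) \<Rightarrow> (nat \<Rightarrow> nat) \<Rightarrow> bool" where
  "layout X P tok own \<longleftrightarrow> 1 \<le> P \<and> tok 0 = 0 \<and> own 0 = 0 \<and>
     (\<forall>p. own p \<noteq> 0 \<longrightarrow> (\<exists>K. (own p, K) \<in> X \<and> p + length K < P \<and> clause_at tok p K)) \<and>
     (\<forall>(j, K)\<in>X. \<exists>p. own p = j \<and> p + length K < P \<and> clause_at tok p K)"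

lemma layout_owner:
  assumes "layout X P tok own" "own p \<noteq> 0"
  obtains K where "(own p, K) \<in> X" "p + length K < P" "clause_at tok p K"
  using assms unfolding layout_def by blast

lemma layout_address:
  assumes "layout X P tok own" "(j, K) \<in> X"
  obtains p where "own p = j" "p + length K < P" "clause_at tok p K"
  using assms unfolding layout_def by blast

text \<open>Everything stored so far ends before \<open>P\<close>, so writing from \<open>P\<close>
  on destroys nothing, and \<open>P\<close> itself had no owner yet.\<close>

lemma layout_insert:
  assumes lay: "layout X P tok own" and j: "j \<noteq> 0"
    and tok': "\<And>p. p < P \<Longrightarrow> tok' p = tok p" "clause_at tok' P K"
  shows "layout (insert (j, K) X) (P + 1 + length K) tok' (own(P := j))"
proof -
  have old: "clause_at tok' p K'" if "p + length K' < P" "clause_at tok p K'" for p K'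
    using that tok'(1) by (simp add: clause_at_def)
  have "\<exists>K'. ((own(P := j)) p, K') \<in> insert (j, K) X \<and> p + length K' < P + 1 + length K \<and>
      clause_at tok' p K'" if p: "(own(P := j)) p \<noteq> 0" for p
  proof (cases "p = P")
    case True
    with tok'(2) show ?thesis
      by auto
  next
    case False
    with p obtain K' where "(own p, K') \<in> X" "p + length K' < P" "clause_at tok p K'"
      using layout_owner[OF lay, of p] by auto
    with False old show ?thesis
      by (intro exI[of _ K']) auto
  qed
  moreover have "\<exists>p. (own(P := j)) p = j' \<and> p + length K' < P + 1 + length K \<and>
      clause_at tok' p K'" if X: "(j', K') \<in> insert (j, K) X" for j' K'
  proof (cases "(j', K') = (j, K)")
    case True
    with tok'(2) show ?thesis
      by (intro exI[of _ P]) simp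
  next
    case False
    with X obtain p where "own p = j'" "p + length K' < P" "clause_at tok p K'"
      using layout_address[OF lay, of j' K'] by auto
    with old show ?thesis
      by (intro exI[of _ p]) auto
  qed
  moreover have "1 \<le> P + 1 + length K" "tok' 0 = 0" "(own(P := j)) 0 = 0"
    using lay tok'(1)[of 0] by (auto simp: layout_def)
  ultimately show ?thesis
    unfolding layout_def case_prod_unfold by (metis prod.collapse)
qed

text \<open>The bound \<open>g i\<close> may vary with the round, since conjunctions and formulas
  differ in length; adding up the rounds then gives time linear in the input.\<close>

lemma For_invariant_time:
  assumes "eval e s = n" "I 0 s"
    "\<And>i s. i < n \<Longrightarrow> I i s \<Longrightarrow> I (Suc i) (run c (set_var x i s)) \<and> time c (set_var x i s) \<le> g i"
  shows "I n (run (For x e c) s)" "time (For x e c) s \<le> exp_size e + 7 + (\<Sum>i<n. 7 + g i)"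
proof -
  let ?f = "\<lambda>i s. run c (set_var x i s)"
  show "I n (run (For x e c) s)"
    using assms(1,2) by (rule run_For_invariant) (use assms(3) in blast)
  have "I k (iter ?f k s)" if "k \<le> n" for k
    using assms(2) by (rule iter_invariant) (use assms(3) that in simp)
  then have "time c (set_var x k (iter ?f k s)) \<le> g k" if "k < n" for k
    using assms(3) that by simp
  then have "(\<Sum>i<n. 7 + time c (set_var x i (iter ?f i s))) \<le> (\<Sum>i<n. 7 + g i)"
    by (intro sum_mono) simp
  then show "time (For x e c) s \<le> exp_size e + 7 + (\<Sum>i<n. 7 + g i)"
    using assms(1) by simp
qed

lemma read_literals:
  assumes "inq s = K @ w" "vr s LitLen = length K" "vr s Ptr = P"
  defines "s' \<equiv> run read_literals s"
  shows "inq s' = w" "vr s' Ptr = P + length K"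
    "ar s' Token = (\<lambda>p. if P \<le> p \<and> p < P + length K then K ! (p - P) else ar s Token p)"
    "time read_literals s \<le> 9 + 25 * length K"
proof -
  let ?I = "\<lambda>i s'. inq s' = drop i K @ w \<and> vr s' Ptr = P + i \<and>
     ar s' Token = (\<lambda>p. if P \<le> p \<and> p < P + i then K ! (p - P) else ar s Token p)"
  \<comment> \<open>A round costs 1 for \<open>Input\<close>, 11 for \<open>Write\<close> and 6 for
    \<open>Assign\<close>, besides the overhead 7.\<close>
  have "?I (length K) s'" "time read_literals s \<le> exp_size (Var LitLen) + 7 + (\<Sum>i<length K. 7 + 18)"
    unfolding s'_def read_literals_def
    by (rule For_invariant_time[where I = ?I];
      use assms(1-3) in \<open>auto simp: fun_eq_iff Cons_nth_drop_Suc[symmetric]\<close>)+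
  then show "inq s' = w" "vr s' Ptr = P + length K"
    "ar s' Token = (\<lambda>p. if P \<le> p \<and> p < P + length K then K ! (p - P) else ar s Token p)"
    "time read_literals s \<le> 9 + 25 * length K"
    by simp_all
qed

lemma read_clause:
  assumes "inq s = length K # K @ w" "layout X (vr s Ptr) (ar s Token) (ar s Owner)"
    "vr s Job \<noteq> 0"
  defines "s' \<equiv> run read_clause s"
  shows "inq s' = w" "layout (insert (vr s Job, K) X) (vr s' Ptr) (ar s' Token) (ar s' Owner)"
    "vr s' Ptr = vr s Ptr + 1 + length K" "time read_clause s \<le> 38 * (1 + length K)"
proof -
  let ?P = "vr s Ptr"
  define s1 where "s1 = run (Input LitLen ;; Write Token (Var Ptr) (Var LitLen) ;;
     Write Owner (Var Ptr) (Var Job) ;; Assign Ptr (incr (Var Ptr))) s"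
  have s1: "inq s1 = K @ w" "vr s1 LitLen = length K" "vr s1 Ptr = ?P + 1"
    "ar s1 Token = (ar s Token)(?P := length K)" "ar s1 Owner = (ar s Owner)(?P := vr s Job)"
    by (simp_all add: s1_def assms(1))
  have s': "s' = run read_literals s1"
    by (simp add: s'_def s1_def read_clause_def)
  note lits = read_literals[OF s1(1-3), folded s']
  show "inq s' = w"
    by (fact lits)
  show ptr: "vr s' Ptr = ?P + 1 + length K"
    using lits by simp
  have "ar s' Owner = (ar s Owner)(?P := vr s Job)"
    unfolding s' s1(5)[symmetric] by (rule ar_run) (simp add: read_literals_def)
  moreover have "clause_at (ar s' Token) ?P K"
    using lits(3) s1(4) by (simp add: clause_at_def)
  moreover have "ar s' Token p = ar s Token p" if "p < ?P" for p
    using that lits(3) s1(4) by simp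
  ultimately show "layout (insert (vr s Job, K) X) (vr s' Ptr) (ar s' Token) (ar s' Owner)"
    unfolding ptr using layout_insert[OF assms(2,3)] by simp
  \<comment> \<open>The 29 steps before the literals and the 9 that start their loop make up the
    constant 38.\<close>
  have "time read_clause s = 29 + time read_literals s1"
    by (simp add: read_clause_def s1_def)
  with lits(4) show "time read_clause s \<le> 38 * (1 + length K)"
    by simp
qed

fun clauses :: "nat \<Rightarrow> formula \<Rightarrow> (nat \<times> nat list) set" where
  "clauses j One = {}"
| "clauses j (DNF F) = Pair j ` set F"

lemma read_formula:
  assumes "inq s = encode_formula \<phi> @ w" "layout X (vr s Ptr) (ar s Token) (ar s Owner)"
    "vr s Job \<noteq> 0"
  defines "s' \<equiv> run read_formula s"
  shows "inq s' = w" "layout (clauses (vr s Job) \<phi> \<union> X) (vr s' Ptr) (ar s' Token) (ar s' Owner)"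
    "vr s' Ptr \<le> vr s Ptr + length (encode_formula \<phi>)"
    "ar s' Succ = (ar s Succ)(vr s Job := (if \<phi> = One then 0 else 1))"
    "time read_formula s \<le> 45 * length (encode_formula \<phi>)"
proof -
  let ?j = "vr s Job"
  have "inq s' = w \<and> layout (clauses ?j \<phi> \<union> X) (vr s' Ptr) (ar s' Token) (ar s' Owner) \<and>
     vr s' Ptr \<le> vr s Ptr + length (encode_formula \<phi>) \<and>
     ar s' Succ = (ar s Succ)(?j := (if \<phi> = One then 0 else 1)) \<and>
     time read_formula s \<le> 45 * length (encode_formula \<phi>)"
  proof (cases \<phi>)
    case One
    then show ?thesis
      using assms(1,2) by (simp add: s'_def read_formula_def)
  next
    case (DNF F)
    let ?enc = "\<lambda>F. concat (map (\<lambda>K. length K # K) F)"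
    define s1 where "s1 = run (Input Tag ;; Write Succ (Var Job) (Var Tag) ;; Input Len) s"
    have s1: "inq s1 = ?enc F @ w" "vr s1 Len = length F" "vr s1 Ptr = vr s Ptr"
      "vr s1 Job = ?j" "ar s1 Token = ar s Token" "ar s1 Owner = ar s Owner"
      "ar s1 Succ = (ar s Succ)(?j := 1)"
      using assms(1) DNF by (simp_all add: s1_def)
    have s': "s' = run (For Pos (Var Len) read_clause) s1"
      using assms(1) DNF by (simp add: s'_def s1_def read_formula_def)
    \<comment> \<open>A conjunction takes up as many cells as it has entries in the input, so the
      free address plus the length of the unread part does not grow.\<close>
    let ?I = "\<lambda>i s'. inq s' = ?enc (drop i F) @ w \<and> vr s' Job = ?j \<and>
      layout (Pair ?j ` set (take i F) \<union> X) (vr s' Ptr) (ar s' Token) (ar s' Owner) \<and>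
      vr s' Ptr + length (?enc (drop i F)) \<le> vr s Ptr + length (?enc F)"
    let ?g = "\<lambda>i. 38 * (1 + length (F ! i))"
    have step: "?I (Suc i) (run read_clause (set_var Pos i s2)) \<and>
        time read_clause (set_var Pos i s2) \<le> ?g i" if i: "i < length F" and I: "?I i s2" for i s2
    proof -
      let ?s2 = "set_var Pos i s2"
      have enc: "?enc (drop i F) = length (F ! i) # F ! i @ ?enc (drop (Suc i) F)"
        using i by (simp add: Cons_nth_drop_Suc[symmetric])
      then have "inq ?s2 = length (F ! i) # F ! i @ ?enc (drop (Suc i) F) @ w"
        using I by simp
      note cl = read_clause[OF this, of "Pair ?j ` set (take i F) \<union> X"]
      have "insert (?j, F ! i) (Pair ?j ` set (take i F) \<union> X) =
          Pair ?j ` set (take (Suc i) F) \<union> X"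
        using i by (simp add: take_Suc_conv_app_nth)
      moreover have "vr (run read_clause ?s2) Job = vr ?s2 Job"
        by (rule vr_run) (simp add: read_clause_def read_literals_def)
      ultimately show ?thesis
        using cl I enc assms(3) by simp
    qed
    have "?I (length F) s'" "time (For Pos (Var Len) read_clause) s1 \<le>
        exp_size (Var Len) + 7 + (\<Sum>i<length F. 7 + ?g i)"
      unfolding s'
      by (rule For_invariant_time[where I = ?I, OF _ _ step]; use s1 assms(2) in simp)+
    moreover have "ar s' Succ = ar s1 Succ"
      unfolding s' by (rule ar_run) (simp add: read_clause_def read_literals_def)
    \<comment> \<open>45 is 38 plus the overhead 7 of a round, charged to the entry that holds the
      length of the conjunction.\<close>
    moreover have "(\<Sum>i<length F. 7 + ?g i) \<le> 45 * length (?enc F)"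
    proof -
      have "length (?enc F) = (\<Sum>i<length F. 1 + length (F ! i))"
        by (simp add: length_concat comp_def sum_list_sum_nth atLeast0LessThan)
      then have "45 * length (?enc F) = (\<Sum>i<length F. 45 * (1 + length (F ! i)))"
        by (simp only: sum_distrib_left)
      moreover have "(\<Sum>i<length F. 7 + ?g i) \<le> (\<Sum>i<length F. 45 * (1 + length (F ! i)))"
        by (intro sum_mono) simp
      ultimately show ?thesis
        by simp
    qed
    moreover have "time read_formula s = 16 + time (For Pos (Var Len) read_clause) s1"
      using assms(1) DNF by (simp add: read_formula_def s1_def)
    ultimately show ?thesis
      using DNF s1 by simp
  qed
  then show "inq s' = w" "layout (clauses ?j \<phi> \<union> X) (vr s' Ptr) (ar s' Token) (ar s' Owner)"
    "vr s' Ptr \<le> vr s Ptr + length (encode_formula \<phi>)"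
    "ar s' Succ = (ar s Succ)(?j := (if \<phi> = One then 0 else 1))"
    "time read_formula s \<le> 45 * length (encode_formula \<phi>)"
    by blast+
qed

definition represents_instance :: "sched_instance \<Rightarrow> state \<Rightarrow> bool" where
  "represents_instance I s \<longleftrightarrow> vr s NumJobs = num_jobs I \<and> vr s Machines = machines I \<and>
     (\<exists>P. layout (\<Union>j\<in>jobs I. clauses j (constr I j)) P (ar s Token) (ar s Owner) \<and>
        vr s Bound = P + num_jobs I + 2) \<and>
     (\<forall>j\<in>jobs I. ar s Succ j = (if constr I j = One then 0 else 1))"

text \<open>The free address plus the unread input never grows, so \<open>Ptr\<close> stays within
  the length of the input. Every job contributes at least one entry, so the number of jobs does too;
  together they bound \<open>Bound\<close> linearly.\<close>

lemma read_instance: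
  fixes I :: sched_instance
  notes upt_Suc [simp del]
  defines "w \<equiv> encode_instance I"
  defines "s' \<equiv> run read_instance (start w)"
  shows "represents_instance I s'" "vr s' Bound \<le> 2 * length w + 3"
    "time read_instance (start w) \<le> 100 * length w"
proof -
  let ?n = "num_jobs I"
  let ?enc = "\<lambda>js. concat (map (\<lambda>j. encode_formula (constr I j)) js)"
  define s1 where "s1 = run (Input NumJobs ;; Input Machines ;; Assign Ptr (Num 1)) (start w)"
  define s2 where "s2 = run (For Idx (Var NumJobs) (Assign Job (incr (Var Idx)) ;; read_formula)) s1"
  have w: "w = ?n # machines I # ?enc [1..<?n + 1]"
    by (simp add: w_def encode_instance_def)
  have s1: "inq s1 = ?enc [1..<?n + 1]" "vr s1 NumJobs = ?n" "vr s1 Machines = machines I"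
    "vr s1 Ptr = 1" "ar s1 = (\<lambda>_ _. 0)"
    by (simp_all add: s1_def w start_def)
  have s': "s' = run (Assign Bound (Plus (Var Ptr) (Plus (Var NumJobs) (Num 2)))) s2"
    by (simp add: s'_def s2_def s1_def read_instance_def)
  let ?X = "\<lambda>i. \<Union>j\<in>{1..i}. clauses j (constr I j)"
  let ?I = "\<lambda>i s. inq s = ?enc [i + 1..<?n + 1] \<and>
     layout (?X i) (vr s Ptr) (ar s Token) (ar s Owner) \<and>
     vr s Ptr + length (?enc [i + 1..<?n + 1]) \<le> length w \<and>
     (\<forall>j\<in>{1..i}. ar s Succ j = (if constr I j = One then 0 else 1))"
  let ?c = "Assign Job (incr (Var Idx)) ;; read_formula"
  let ?g = "\<lambda>i. 6 + 45 * length (encode_formula (constr I (i + 1)))"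
  have step: "?I (Suc i) (run ?c (set_var Idx i s)) \<and> time ?c (set_var Idx i s) \<le> ?g i"
    if i: "i < ?n" and I: "?I i s" for i s
  proof -
    let ?s = "set_var Job (i + 1) (set_var Idx i s)"
    have enc: "?enc [i + 1..<?n + 1] = encode_formula (constr I (i + 1)) @ ?enc [i + 2..<?n + 1]"
      using i by (simp add: upt_conv_Cons[of "Suc i"])
    then have "inq ?s = encode_formula (constr I (i + 1)) @ ?enc [i + 2..<?n + 1]"
      using I by simp
    note form = read_formula[OF this, of "?X i"]
    have "clauses (i + 1) (constr I (i + 1)) \<union> ?X i = ?X (Suc i)"
      by (simp add: atLeastAtMostSuc_conv)
    with form I enc show ?thesis
      by (auto simp: le_Suc_eq)
  qed
  have fin: "?I ?n s2" and time: "time (For Idx (Var NumJobs) ?c) s1 \<le>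
      exp_size (Var NumJobs) + 7 + (\<Sum>i<?n. 7 + ?g i)"
    unfolding s2_def
    by (rule For_invariant_time[where I = ?I, OF _ _ step];
      use s1 w in \<open>simp add: layout_def\<close>)+
  have frame: "vr s2 NumJobs = ?n" "vr s2 Machines = machines I"
    unfolding s2_def s1(2,3)[symmetric]
    by (rule vr_run, simp add: read_formula_def read_clause_def read_literals_def)+
  show "represents_instance I s'"
    using fin frame by (auto simp: represents_instance_def s' jobs_def)
  have enc_pos: "1 \<le> length (encode_formula \<phi>)" for \<phi>
    by (cases \<phi>) simp_all
  have enc_len: "length (?enc [1..<?n + 1]) = (\<Sum>i<?n. length (encode_formula (constr I (i + 1))))"
    by (simp add: length_concat comp_def sum_list_sum_nth atLeast0LessThan)
  have "?n \<le> (\<Sum>i<?n. length (encode_formula (constr I (i + 1))))"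
    using sum_mono[of "{..<?n}" "\<lambda>_. 1", OF enc_pos] by simp
  with fin frame show "vr s' Bound \<le> 2 * length w + 3"
    using w enc_len by (simp add: s')
  have "(\<Sum>i<?n. 7 + ?g i) \<le> (\<Sum>i<?n. 58 * length (encode_formula (constr I (i + 1))))"
    using enc_pos by (intro sum_mono) (simp add: algebra_simps)
  also have "\<dots> = 58 * length (?enc [1..<?n + 1])"
    unfolding enc_len by (simp only: sum_distrib_left)
  finally have le: "(\<Sum>i<?n. 7 + ?g i) \<le> 58 * length (?enc [1..<?n + 1])" .
  define L where "L = For Idx (Var NumJobs) ?c"
  have "time read_instance (start w) = time L s1 + 14"
    unfolding read_instance_def L_def[symmetric] s1_def by simp
  then show "time read_instance (start w) \<le> 100 * length w"
    using time le w by (simp add: L_def del: time.simps)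
qed

subsection \<open>Building the schedule for a guess\<close>

text \<open>The due date \<open>Bound - 1\<close> stands for no deadline: compressed schedules meet
  it strictly, and it is still below \<open>Bound\<close>, so that \<open>edf\<close> reaches
  it.\<close>

definition clear :: cmd where
  "clear = For Idx (Var Bound) (Write Compl (Var Idx) (Num 0) ;;
     Write Due (Var Idx) (Minus (Var Bound) (Num 1)) ;; Write Load_at (Var Idx) (Num 0))"

text \<open>The cap makes the loop bound \<open>fixed\<close>. Stored conjunctions are shorter than
  \<open>Bound\<close>, so all their literals are reached. Taking the minimum matters because a job
  can occur in several guessed conjunctions.\<close>

definition lower_due :: cmd where
  "lower_due = For Count (capped (Arr Token (Var Pos)))
     (Assign Job (Arr Token (Plus (incr (Var Pos)) (Var Count))) ;;
      When (less (Var Time) (Arr Due (Var Job))) (Write Due (Var Job) (Var Time)))"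

definition fix_successors :: "nat \<Rightarrow> cmd" where
  "fix_successors c = For Slot (Num c)
     (Assign Pos (Arr GuessPos (Var Slot)) ;; Assign Time (Arr GuessTime (Var Slot)) ;;
      Write Compl (Arr Owner (Var Pos)) (Var Time) ;; lower_due)"

definition count_fixed :: cmd where
  "count_fixed = Assign Ok (Num 1) ;; For Idx (capped (Var NumJobs))
     (Assign Job (incr (Var Idx)) ;;
      Cond (Arr Compl (Var Job))
        (Write Load_at (Arr Compl (Var Job)) (incr (Arr Load_at (Arr Compl (Var Job)))))
        (When (Arr Succ (Var Job)) (Assign Ok (Num 0))))"

text \<open>Slots start at 1, so \<open>Place = 0\<close> can signal that none is free.\<close>

definition find_slot :: cmd where
  "find_slot = Assign Place (Num 0) ;; For Time (Minus (Var Bound) (Num 1))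
     (When (less (Var Place) (Num 1))
       (When (less (Arr Load_at (incr (Var Time))) (Var Machines))
         (Assign Place (incr (Var Time)))))"

text \<open>If no slot is free, the job gets time 0, that is, it stays unscheduled, and
  \<open>check_slots\<close> rejects the guess; no early exit is needed.\<close>

definition place_job :: cmd where
  "place_job = Assign Job (incr (Var Idx)) ;; Cond (Arr Compl (Var Job)) Skip
     (When (less (Arr Due (Var Job)) (incr (Var Deadline)))
       (find_slot ;; Write Compl (Var Job) (Var Place) ;;
        Write Load_at (Var Place) (incr (Arr Load_at (Var Place)))))"

text \<open>Running through all possible deadlines outside and all jobs inside takes the place of
  sorting the jobs.\<close>

definition edf :: cmd where
  "edf = For Deadline (Var Bound) (For Idx (capped (Var NumJobs)) place_job)"

lemmas build_defs = clear_def lower_due_def fix_successors_def count_fixed_def find_slot_def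
  place_job_def edf_def

lemma run_clear:
  assumes "i < vr s Bound"
  shows "ar (run clear s) Compl i = 0" "ar (run clear s) Due i = vr s Bound - 1"
    "ar (run clear s) Load_at i = 0"
proof -
  let ?I = "\<lambda>k s'. vr s' Bound = vr s Bound \<and> (\<forall>i<k. ar s' Compl i = 0 \<and>
    ar s' Due i = vr s Bound - 1 \<and> ar s' Load_at i = 0)"
  have "?I (vr s Bound) (run clear s)"
    unfolding clear_def by (rule run_For_invariant[where I = ?I]) (auto simp: less_Suc_eq)
  with assms show "ar (run clear s) Compl i = 0" "ar (run clear s) Due i = vr s Bound - 1"
    "ar (run clear s) Load_at i = 0"
    by blast+
qed

lemma run_lower_due:
  fixes s :: state
  defines "tok \<equiv> ar s Token" and "p \<equiv> vr s Pos" and "t \<equiv> vr s Time" and "D \<equiv> ar s Due"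
    and "D' \<equiv> ar (run lower_due s) Due"
  shows "D' i \<le> D i" "D' i = D i \<or> D' i = t \<and> (\<exists>l<tok p. tok (p + 1 + l) = i)"
    "l < tok p \<Longrightarrow> l < vr s Bound \<Longrightarrow> D' (tok (p + 1 + l)) \<le> t"
proof -
  let ?I = "\<lambda>k s'. ar s' Token = tok \<and> vr s' Pos = p \<and> vr s' Time = t \<and>
    (\<forall>i. ar s' Due i \<le> D i \<and> (ar s' Due i = D i \<or> ar s' Due i = t \<and> (\<exists>l<k. tok (p + 1 + l) = i))) \<and>
    (\<forall>l<k. ar s' Due (tok (p + 1 + l)) \<le> t)"
  have "?I (vr s Bound - (vr s Bound - tok p)) (run lower_due s)"
    unfolding lower_due_def
  proof (rule run_For_invariant[where I = ?I])
    fix k and s' :: state assume "?I k s'"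
    then show "?I (Suc k) (run (Assign Job (Arr Token (Plus (incr (Var Pos)) (Var Count))) ;;
      When (less (Var Time) (Arr Due (Var Job))) (Write Due (Var Job) (Var Time)))
        (set_var Count k s'))"
      by (auto simp: less_Suc_eq intro: less_imp_le[OF order.strict_trans2])
  qed (simp_all add: assms)
  then have due: "D' i \<le> D i \<and> (D' i = D i \<or> D' i = t \<and>
      (\<exists>l<vr s Bound - (vr s Bound - tok p). tok (p + 1 + l) = i))"
    and literal: "\<forall>l<vr s Bound - (vr s Bound - tok p). D' (tok (p + 1 + l)) \<le> t" for i
    unfolding D'_def by simp_all
  show "D' i \<le> D i"
    using due by simp
  have "l < tok p" if "l < vr s Bound - (vr s Bound - tok p)" for l
    using that by simp
  with due[of i] show "D' i = D i \<or> D' i = t \<and> (\<exists>l<tok p. tok (p + 1 + l) = i)"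
    by blast
  show "D' (tok (p + 1 + l)) \<le> t" if "l < tok p" "l < vr s Bound"
    using literal that by simp
qed

text \<open>Holds for arbitrary guesses. Several slots may have the same owner, and the last one
  wins; so a fixed time is only known to come from some slot \<open>r'\<close> with that
  owner.\<close>

lemma run_fix_successors:
  fixes s :: state and c :: nat
  defines "own \<equiv> ar s Owner" and "q \<equiv> ar s GuessPos" and "t \<equiv> ar s GuessTime"
    and "s' \<equiv> run (fix_successors c) s"
  shows "ar s' Compl j = ar s Compl j \<or> (\<exists>r<c. own (q r) = j \<and> ar s' Compl j = t r)"
    "r < c \<Longrightarrow> \<exists>r'<c. own (q r') = own (q r) \<and> ar s' Compl (own (q r)) = t r'"
    "ar s' Due i = ar s Due i \<or> (\<exists>r<c. ar s' Due i = t r \<and>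
       (\<exists>l<ar s Token (q r). ar s Token (q r + 1 + l) = i))"
    "r < c \<Longrightarrow> l < ar s Token (q r) \<Longrightarrow> l < vr s Bound \<Longrightarrow>
       ar s' Due (ar s Token (q r + 1 + l)) \<le> t r"
proof -
  let ?tok = "ar s Token"
  let ?I = "\<lambda>k s'. ar s' Owner = own \<and> ar s' GuessPos = q \<and> ar s' GuessTime = t \<and>
    ar s' Token = ?tok \<and> vr s' Bound = vr s Bound \<and>
    (\<forall>j. ar s' Compl j = ar s Compl j \<or> (\<exists>r<k. own (q r) = j \<and> ar s' Compl j = t r)) \<and>
    (\<forall>r<k. \<exists>r'<k. own (q r') = own (q r) \<and> ar s' Compl (own (q r)) = t r') \<and>
    (\<forall>i. ar s' Due i = ar s Due i \<or> (\<exists>r<k. ar s' Due i = t r \<and>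
       (\<exists>l<?tok (q r). ?tok (q r + 1 + l) = i))) \<and>
    (\<forall>r<k. \<forall>l. l < ?tok (q r) \<and> l < vr s Bound \<longrightarrow> ar s' Due (?tok (q r + 1 + l)) \<le> t r)"
  have "?I c s'"
    unfolding s'_def fix_successors_def
  proof (rule run_For_invariant[where I = ?I])
    fix k and s1 :: state assume I: "?I k s1"
    let ?c = "Assign Pos (Arr GuessPos (Var Slot)) ;; Assign Time (Arr GuessTime (Var Slot)) ;;
      Write Compl (Arr Owner (Var Pos)) (Var Time)"
    define s2 where "s2 = run ?c (set_var Slot k s1)"
    have s2: "ar s2 Owner = own" "ar s2 GuessPos = q" "ar s2 GuessTime = t" "ar s2 Token = ?tok"
      "vr s2 Bound = vr s Bound" "vr s2 Pos = q k" "vr s2 Time = t k" "ar s2 Due = ar s1 Due"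
      "ar s2 Compl = (ar s1 Compl)(own (q k) := t k)"
      using I by (simp_all add: s2_def)
    define s3 where "s3 = run lower_due s2"
    have s3: "ar s3 Owner = own" "ar s3 GuessPos = q" "ar s3 GuessTime = t" "ar s3 Token = ?tok"
      "vr s3 Bound = vr s Bound" "ar s3 Compl = (ar s1 Compl)(own (q k) := t k)"
      by (simp_all add: s3_def vr_run ar_run s2 lower_due_def del: run.simps)
    note due = run_lower_due[where s = s2, unfolded s2, folded s3_def]
    have "\<forall>j. ar s3 Compl j = ar s Compl j \<or> (\<exists>r<Suc k. own (q r) = j \<and> ar s3 Compl j = t r)"
      using I s3 by (auto simp: less_Suc_eq)
    moreover have "\<forall>r<Suc k. \<exists>r'<Suc k. own (q r') = own (q r) \<and> ar s3 Compl (own (q r)) = t r'"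
    proof (intro allI impI)
      fix r assume "r < Suc k"
      show "\<exists>r'<Suc k. own (q r') = own (q r) \<and> ar s3 Compl (own (q r)) = t r'"
      proof (cases "own (q r) = own (q k)")
        case True
        then show ?thesis
          using s3 by auto
      next
        case False
        with \<open>r < Suc k\<close> have "r < k"
          by (auto simp: less_Suc_eq)
        with I obtain r' where "r' < k" "own (q r') = own (q r)" "ar s1 Compl (own (q r)) = t r'"
          by blast
        with False s3 show ?thesis
          by (intro exI[of _ r']) simp
      qed
    qed
    moreover have "\<forall>i. ar s3 Due i = ar s Due i \<or> (\<exists>r<Suc k. ar s3 Due i = t r \<and>
       (\<exists>l<?tok (q r). ?tok (q r + 1 + l) = i))"
    proof
      fix i
      from I have "ar s1 Due i = ar s Due i \<or> (\<exists>r<k. ar s1 Due i = t r \<and>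
        (\<exists>l<?tok (q r). ?tok (q r + 1 + l) = i))"
        by blast
      with due(2)[of i] show "ar s3 Due i = ar s Due i \<or> (\<exists>r<Suc k. ar s3 Due i = t r \<and>
         (\<exists>l<?tok (q r). ?tok (q r + 1 + l) = i))"
        by (metis less_Suc_eq)
    qed
    moreover have "\<forall>r<Suc k. \<forall>l. l < ?tok (q r) \<and> l < vr s Bound \<longrightarrow>
        ar s3 Due (?tok (q r + 1 + l)) \<le> t r"
    proof (intro allI impI)
      fix r l assume r: "r < Suc k" and l: "l < ?tok (q r) \<and> l < vr s Bound"
      show "ar s3 Due (?tok (q r + 1 + l)) \<le> t r"
      proof (cases "r = k")
        case True
        with l due(3) show ?thesis
          by blast
      next
        case False
        with r have "r < k"
          by simp
        with I l have "ar s1 Due (?tok (q r + 1 + l)) \<le> t r"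
          by blast
        with due(1) show ?thesis
          by (rule order.trans)
      qed
    qed
    ultimately have "?I (Suc k) s3"
      using s3 by blast
    then show "?I (Suc k) (run (Assign Pos (Arr GuessPos (Var Slot)) ;;
      Assign Time (Arr GuessTime (Var Slot)) ;; Write Compl (Arr Owner (Var Pos)) (Var Time) ;;
      lower_due) (set_var Slot k s1))"
      by (simp add: s3_def s2_def)
  qed (simp_all add: assms)
  then show "ar s' Compl j = ar s Compl j \<or> (\<exists>r<c. own (q r) = j \<and> ar s' Compl j = t r)"
    "r < c \<Longrightarrow> \<exists>r'<c. own (q r') = own (q r) \<and> ar s' Compl (own (q r)) = t r'"
    "ar s' Due i = ar s Due i \<or> (\<exists>r<c. ar s' Due i = t r \<and>
       (\<exists>l<ar s Token (q r). ar s Token (q r + 1 + l) = i))"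
    "r < c \<Longrightarrow> l < ar s Token (q r) \<Longrightarrow> l < vr s Bound \<Longrightarrow>
       ar s' Due (ar s Token (q r + 1 + l)) \<le> t r"
    by blast+
qed

lemma run_count_fixed:
  fixes s :: state
  defines "s' \<equiv> run count_fixed s" and "n \<equiv> vr s NumJobs" and "C \<equiv> ar s Compl"
  assumes n: "n \<le> vr s Bound"
  shows "vr s' Ok > 0 \<longleftrightarrow> (\<forall>j\<in>{1..n}. C j > 0 \<or> ar s Succ j = 0)"
    "1 \<le> t \<Longrightarrow> ar s' Load_at t = ar s Load_at t + card {j \<in> {1..n}. C j = t}"
proof -
  let ?I = "\<lambda>k s'. ar s' Compl = C \<and> ar s' Succ = ar s Succ \<and>
    (vr s' Ok > 0 \<longleftrightarrow> (\<forall>j\<in>{1..k}. C j > 0 \<or> ar s Succ j = 0)) \<and>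
    (\<forall>t\<ge>1. ar s' Load_at t = ar s Load_at t + card {j \<in> {1..k}. C j = t})"
  have "?I n s'"
    unfolding s'_def count_fixed_def run.simps(4)
  proof (rule run_For_invariant[where I = ?I])
    fix k and s1 :: state assume I: "?I k s1"
    have "{j \<in> {1..Suc k}. C j = t} = (if C (Suc k) = t then insert (Suc k) {j \<in> {1..k}. C j = t}
        else {j \<in> {1..k}. C j = t})" for t
      by (auto simp: le_Suc_eq)
    then have count: "card {j \<in> {1..Suc k}. C j = t} =
        card {j \<in> {1..k}. C j = t} + (if C (Suc k) = t then 1 else 0)" for t
      by simp
    have ball: "(\<forall>j\<in>{1..Suc k}. C j > 0 \<or> ar s Succ j = 0) \<longleftrightarrow>
        (\<forall>j\<in>{1..k}. C j > 0 \<or> ar s Succ j = 0) \<and> (C (Suc k) > 0 \<or> ar s Succ (Suc k) = 0)"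
      by (auto simp: atLeastAtMostSuc_conv)
    show "?I (Suc k) (run (Assign Job (incr (Var Idx)) ;;
      Cond (Arr Compl (Var Job))
        (Write Load_at (Arr Compl (Var Job)) (incr (Arr Load_at (Arr Compl (Var Job)))))
        (When (Arr Succ (Var Job)) (Assign Ok (Num 0)))) (set_var Idx k s1))"
      unfolding count ball using I by auto
  qed (use n in \<open>simp_all add: n_def C_def\<close>)
  then show "vr s' Ok > 0 \<longleftrightarrow> (\<forall>j\<in>{1..n}. C j > 0 \<or> ar s Succ j = 0)"
    and "1 \<le> t \<Longrightarrow> ar s' Load_at t = ar s Load_at t + card {j \<in> {1..n}. C j = t}"
    by (elim conjE; simp)+
qed

lemma run_find_slot:
  fixes s :: state
  defines "p \<equiv> vr (run find_slot s) Place" and "N \<equiv> vr s Bound" and "m \<equiv> vr s Machines"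
    and "L \<equiv> ar s Load_at"
  shows "p = 0 \<Longrightarrow> 1 \<le> t \<Longrightarrow> t < N \<Longrightarrow> m \<le> L t"
    "p \<noteq> 0 \<Longrightarrow> p < N \<and> L p < m" "p \<noteq> 0 \<Longrightarrow> 1 \<le> t \<Longrightarrow> t < p \<Longrightarrow> m \<le> L t"
proof -
  let ?I = "\<lambda>k s'. ar s' Load_at = L \<and> vr s' Machines = m \<and>
    (vr s' Place = 0 \<longrightarrow> (\<forall>t. 1 \<le> t \<and> t \<le> k \<longrightarrow> m \<le> L t)) \<and>
    (vr s' Place \<noteq> 0 \<longrightarrow> vr s' Place \<le> k \<and> L (vr s' Place) < m \<and>
      (\<forall>t. 1 \<le> t \<and> t < vr s' Place \<longrightarrow> m \<le> L t))"
  have "?I (N - 1) (run find_slot s)"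
    unfolding find_slot_def run.simps(4)
  proof (rule run_For_invariant[where I = ?I])
    fix k and s' :: state assume "?I k s'"
    then show "?I (Suc k) (run (When (less (Var Place) (Num 1))
       (When (less (Arr Load_at (incr (Var Time))) (Var Machines))
         (Assign Place (incr (Var Time))))) (set_var Time k s'))"
      by (auto simp: le_Suc_eq less_Suc_eq_le)
  qed (simp_all add: assms)
  then show "p = 0 \<Longrightarrow> 1 \<le> t \<Longrightarrow> t < N \<Longrightarrow> m \<le> L t"
    "p \<noteq> 0 \<Longrightarrow> p < N \<and> L p < m" "p \<noteq> 0 \<Longrightarrow> 1 \<le> t \<Longrightarrow> t < p \<Longrightarrow> m \<le> L t"
    unfolding p_def by auto
qed

lemma run_place_job:
  fixes s :: state
  defines "s' \<equiv> run place_job s" and "j \<equiv> Suc (vr s Idx)" and "N \<equiv> vr s Bound"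
    and "m \<equiv> vr s Machines" and "C \<equiv> ar s Compl" and "L \<equiv> ar s Load_at"
  obtains (unchanged) "C j \<noteq> 0 \<or> vr s Deadline < ar s Due j" "ar s' Compl = C" "ar s' Load_at = L"
  | (placed) p where "C j = 0" "ar s Due j \<le> vr s Deadline"
      "ar s' Compl = C(j := p)" "ar s' Load_at = L(p := L p + 1)"
      "p = 0 \<longrightarrow> (\<forall>t. 1 \<le> t \<and> t < N \<longrightarrow> m \<le> L t)"
      "p \<noteq> 0 \<longrightarrow> p < N \<and> L p < m \<and> (\<forall>t. 1 \<le> t \<and> t < p \<longrightarrow> m \<le> L t)"
proof (cases "C j \<noteq> 0 \<or> vr s Deadline < ar s Due j")
  case True
  then show thesis
    by (intro unchanged) (auto simp: assms place_job_def)
next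
  case False
  let ?s = "set_var Job j s"
  let ?p = "vr (run find_slot ?s) Place"
  have frame: "vr (run find_slot ?s) Job = j" "ar (run find_slot ?s) Compl = C"
    "ar (run find_slot ?s) Load_at = L"
    by (simp_all add: vr_run ar_run find_slot_def C_def L_def del: run.simps)
  have "s' = run (Write Compl (Var Job) (Var Place) ;;
        Write Load_at (Var Place) (incr (Arr Load_at (Var Place)))) (run find_slot ?s)"
    using False by (simp add: s'_def place_job_def j_def C_def)
  then have "ar s' Compl = C(j := ?p)" "ar s' Load_at = L(?p := L ?p + 1)"
    using frame by simp_all
  moreover have "?p = 0 \<longrightarrow> (\<forall>t. 1 \<le> t \<and> t < N \<longrightarrow> m \<le> L t)"
    "?p \<noteq> 0 \<longrightarrow> ?p < N \<and> L ?p < m \<and> (\<forall>t. 1 \<le> t \<and> t < ?p \<longrightarrow> m \<le> L t)"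
    using run_find_slot[where s = ?s] by (auto simp: assms)
  ultimately show thesis
    using False by (intro placed[of ?p]) auto
qed

lemma assigned_place_job: "assigned place_job = {Job, Place, Time}"
  and written_place_job: "written place_job = {Compl, Load_at}"
  by (auto simp: place_job_def find_slot_def)

text \<open>The invariant \<open>P\<close> is a parameter because the loops are analysed twice: in
  \<open>slots\<close> with mere bookkeeping, for every guess, and in \<open>complete\<close> with
  \<open>edf_inv\<close>, for the right guess. The premises on \<open>p\<close> in
  \<open>place\<close> describe the first free slot, or its absence if \<open>p = 0\<close>.\<close>

lemma run_edf:
  fixes s :: state
  defines "n \<equiv> vr s NumJobs" and "N \<equiv> vr s Bound" and "m \<equiv> vr s Machines"
  assumes n: "n \<le> N"
    and init: "P 0 0 (ar s Compl) (ar s Load_at)"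
    and skip: "\<And>d i C L. i < n \<Longrightarrow> P d i C L \<Longrightarrow> C (Suc i) \<noteq> 0 \<or> d < ar s Due (Suc i) \<Longrightarrow>
      P d (Suc i) C L"
    and place: "\<And>d i C L p. i < n \<Longrightarrow> P d i C L \<Longrightarrow> C (Suc i) = 0 \<Longrightarrow> ar s Due (Suc i) \<le> d \<Longrightarrow>
      p = 0 \<longrightarrow> (\<forall>t. 1 \<le> t \<and> t < N \<longrightarrow> m \<le> L t) \<Longrightarrow>
      p \<noteq> 0 \<longrightarrow> p < N \<and> L p < m \<and> (\<forall>t. 1 \<le> t \<and> t < p \<longrightarrow> m \<le> L t) \<Longrightarrow>
      P d (Suc i) (C(Suc i := p)) (L(p := L p + 1))"
    and nxt: "\<And>d C L. P d n C L \<Longrightarrow> P (Suc d) 0 C L"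
  shows "P N 0 (ar (run edf s) Compl) (ar (run edf s) Load_at)"
proof -
  let ?st = "\<lambda>s'. vr s' NumJobs = n \<and> vr s' Bound = N \<and> vr s' Machines = m \<and> ar s' Due = ar s Due"
  let ?I = "\<lambda>d s'. ?st s' \<and> P d 0 (ar s' Compl) (ar s' Load_at)"
  have "?I N (run edf s)"
    unfolding edf_def
  proof (rule run_For_invariant[where I = ?I])
    fix d and s1 :: state assume I: "?I d s1"
    let ?J = "\<lambda>i s'. ?st s' \<and> vr s' Deadline = d \<and> P d i (ar s' Compl) (ar s' Load_at)"
    have "?J n (run (For Idx (capped (Var NumJobs)) place_job) (set_var Deadline d s1))"
    proof (rule run_For_invariant[where I = ?J])
      fix i and s2 :: state assume i: "i < n" and J: "?J i s2"
      let ?s2 = "set_var Idx i s2"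
      let ?s3 = "run place_job ?s2"
      have "?st ?s3 \<and> vr ?s3 Deadline = d"
        using J by (simp add: vr_run ar_run assigned_place_job written_place_job)
      moreover have "P d (Suc i) (ar ?s3 Compl) (ar ?s3 Load_at)"
      proof (cases rule: run_place_job[where s = ?s2])
        case unchanged
        with skip[OF i, of d "ar s2 Compl" "ar s2 Load_at"] J show ?thesis
          by simp
      next
        case (placed p)
        with place[OF i, of d "ar s2 Compl" "ar s2 Load_at" p] J show ?thesis
          by simp
      qed
      ultimately show "?J (Suc i) ?s3"
        by blast
    qed (use I n in simp_all)
    then show "?I (Suc d) (run (For Idx (capped (Var NumJobs)) place_job) (set_var Deadline d s1))"
      using nxt by blast
  qed (use init in \<open>simp_all add: n_def N_def m_def\<close>)
  then show ?thesis
    by blast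
qed

subsection \<open>Checking and recording the schedule\<close>

primrec add_cost :: "objective \<Rightarrow> cmd" where
  "add_cost Makespan =
     When (less (Var Cost) (Arr Compl (Var Job))) (Assign Cost (Arr Compl (Var Job)))"
| "add_cost Sum_Completion = Assign Cost (Plus (Var Cost) (Arr Compl (Var Job)))"

definition check_slots :: "objective \<Rightarrow> cmd" where
  "check_slots \<gamma> = Assign Cost (Num 0) ;; For Idx (capped (Var NumJobs))
     (Assign Job (incr (Var Idx)) ;;
      Cond (Arr Compl (Var Job)) Skip (Assign Ok (Num 0)) ;;
      When (less (Var Machines) (Arr Load_at (Arr Compl (Var Job)))) (Assign Ok (Num 0)) ;;
      add_cost \<gamma>)"

definition check_clause :: cmd where
  "check_clause = For Count (capped (Arr Token (Var Pos)))
     (Cond (less (Arr Compl (Arr Token (Plus (incr (Var Pos)) (Var Count))))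
         (Arr Compl (Arr Owner (Var Pos))))
       Skip (Assign Ok (Num 0)))"

text \<open>Only the guessed conjunctions are tested, not the formulas. This may reject a feasible
  schedule, but accepts no infeasible one once every successor is known to own a slot, which
  \<open>count_fixed\<close> has tested.\<close>

definition check_clauses :: "nat \<Rightarrow> cmd" where
  "check_clauses c = For Slot (Num c) (Assign Pos (Arr GuessPos (Var Slot)) ;; check_clause)"

text \<open>The sum acts as a disjunction. \<open>Found\<close> is needed because the initial value
  0 of \<open>BestCost\<close> is not the cost of a schedule.\<close>

definition record_best :: cmd where
  "record_best = When (Var Ok)
     (When (Plus (less (Var Found) (Num 1)) (less (Var Cost) (Var BestCost)))
       (Assign Found (Num 1) ;; Assign BestCost (Var Cost) ;;
        For Idx (capped (Var NumJobs))
          (Write Best (incr (Var Idx)) (Arr Compl (incr (Var Idx))))))"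

lemma run_check_slots:
  fixes s :: state and \<gamma> :: objective
  defines "s' \<equiv> run (check_slots \<gamma>) s" and "C \<equiv> ar s Compl"
  assumes I: "vr s NumJobs = num_jobs I" "num_jobs I \<ge> 1" "num_jobs I \<le> vr s Bound"
  shows "vr s' Ok > 0 \<longleftrightarrow> vr s Ok > 0 \<and>
      (\<forall>j\<in>jobs I. C j > 0 \<and> ar s Load_at (C j) \<le> vr s Machines)"
    "vr s' Cost = cost \<gamma> I C"
proof -
  let ?n = "num_jobs I"
  \<comment> \<open>The inserted 0 matches the initial value of \<open>Cost\<close> when no job has
    been seen; it does not affect the maximum over a nonempty set of times.\<close>
  let ?cost = "\<lambda>k. case \<gamma> of Makespan \<Rightarrow> Max (insert 0 (C ` {1..k})) | Sum_Completion \<Rightarrow> \<Sum>j\<in>{1..k}. C j"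
  let ?I = "\<lambda>k s'. ar s' Compl = C \<and> ar s' Load_at = ar s Load_at \<and> vr s' Machines = vr s Machines \<and>
    vr s' Cost = ?cost k \<and> (vr s' Ok > 0 \<longleftrightarrow> vr s Ok > 0 \<and>
      (\<forall>j\<in>{1..k}. C j > 0 \<and> ar s Load_at (C j) \<le> vr s Machines))"
  have "?I ?n s'"
    unfolding s'_def check_slots_def run.simps(4)
  proof (rule run_For_invariant[where I = ?I])
    fix k and s1 :: state assume I: "?I k s1"
    let ?c = "Assign Job (incr (Var Idx)) ;;
      Cond (Arr Compl (Var Job)) Skip (Assign Ok (Num 0)) ;;
      When (less (Var Machines) (Arr Load_at (Arr Compl (Var Job)))) (Assign Ok (Num 0))"
    define s2 where "s2 = run ?c (set_var Idx k s1)"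
    have ball: "(\<forall>j\<in>{1..Suc k}. P j) \<longleftrightarrow> (\<forall>j\<in>{1..k}. P j) \<and> P (Suc k)" for P
      by (auto simp: atLeastAtMostSuc_conv)
    have s2: "ar s2 Compl = C" "ar s2 Load_at = ar s Load_at" "vr s2 Machines = vr s Machines"
      "vr s2 Cost = ?cost k" "vr s2 Job = Suc k" "vr s2 Ok > 0 \<longleftrightarrow> vr s Ok > 0 \<and>
      (\<forall>j\<in>{1..Suc k}. C j > 0 \<and> ar s Load_at (C j) \<le> vr s Machines)"
      unfolding ball using I by (auto simp: s2_def)
    have "vr (run (add_cost \<gamma>) s2) Cost = ?cost (Suc k)"
    proof (cases \<gamma>)
      case Makespan
      define M where "M = Max (insert 0 (C ` {1..k}))"
      have "Max (insert 0 (C ` {1..Suc k})) = max (C (Suc k)) M"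
        by (simp add: M_def atLeastAtMostSuc_conv insert_commute[of 0 "C (Suc k)"])
      moreover have "vr s2 Cost = M"
        using s2(4) Makespan by (simp add: M_def)
      ultimately show ?thesis
        using s2(1,5) Makespan by (simp add: max_def)
    next
      case Sum_Completion
      then show ?thesis
        using s2(1,4,5) by simp
    qed
    moreover have "ar (run (add_cost \<gamma>) s2) = ar s2"
      "vr (run (add_cost \<gamma>) s2) Machines = vr s2 Machines"
      "vr (run (add_cost \<gamma>) s2) Ok = vr s2 Ok"
      by (cases \<gamma>; simp)+
    ultimately have "?I (Suc k) (run (add_cost \<gamma>) s2)"
      using s2 by simp
    then show "?I (Suc k) (run (Assign Job (incr (Var Idx)) ;;
      Cond (Arr Compl (Var Job)) Skip (Assign Ok (Num 0)) ;;
      When (less (Var Machines) (Arr Load_at (Arr Compl (Var Job)))) (Assign Ok (Num 0)) ;;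
      add_cost \<gamma>) (set_var Idx k s1))"
      by (simp only: s2_def run.simps)
  qed (use I in \<open>simp_all add: C_def split: objective.split\<close>)
  moreover have "?cost ?n = cost \<gamma> I C"
    using I(2) by (cases \<gamma>) (simp_all add: jobs_def)
  ultimately show "vr s' Ok > 0 \<longleftrightarrow> vr s Ok > 0 \<and>
      (\<forall>j\<in>jobs I. C j > 0 \<and> ar s Load_at (C j) \<le> vr s Machines)"
    "vr s' Cost = cost \<gamma> I C"
    by (simp_all add: jobs_def)
qed

lemma run_check_clause:
  fixes s :: state
  defines "tok \<equiv> ar s Token" and "p \<equiv> vr s Pos" and "C \<equiv> ar s Compl"
  shows "vr (run check_clause s) Ok > 0 \<longleftrightarrow> vr s Ok > 0 \<and>
    (\<forall>l < vr s Bound - (vr s Bound - tok p). C (tok (p + 1 + l)) < C (ar s Owner p))"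
proof -
  let ?I = "\<lambda>k s'. ar s' Token = tok \<and> vr s' Pos = p \<and> ar s' Compl = C \<and>
    ar s' Owner = ar s Owner \<and> (vr s' Ok > 0 \<longleftrightarrow> vr s Ok > 0 \<and>
      (\<forall>l<k. C (tok (p + 1 + l)) < C (ar s Owner p)))"
  have "?I (vr s Bound - (vr s Bound - tok p)) (run check_clause s)"
    unfolding check_clause_def
    by (rule run_For_invariant[where I = ?I]) (auto simp: assms less_Suc_eq)
  then show ?thesis
    by blast
qed

lemma run_check_clauses:
  fixes s :: state
  defines "tok \<equiv> ar s Token" and "q \<equiv> ar s GuessPos" and "C \<equiv> ar s Compl"
  shows "vr (run (check_clauses c) s) Ok > 0 \<longleftrightarrow> vr s Ok > 0 \<and>
    (\<forall>r<c. \<forall>l < vr s Bound - (vr s Bound - tok (q r)).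
       C (tok (q r + 1 + l)) < C (ar s Owner (q r)))"
proof -
  let ?ok = "\<lambda>r. \<forall>l < vr s Bound - (vr s Bound - tok (q r)).
       C (tok (q r + 1 + l)) < C (ar s Owner (q r))"
  let ?I = "\<lambda>k s'. ar s' = ar s \<and> vr s' Bound = vr s Bound \<and>
    (vr s' Ok > 0 \<longleftrightarrow> vr s Ok > 0 \<and> (\<forall>r<k. ?ok r))"
  have "?I c (run (check_clauses c) s)"
    unfolding check_clauses_def
  proof (rule run_For_invariant[where I = ?I])
    fix k and s1 :: state assume I: "?I k s1"
    define s2 where "s2 = run (Assign Pos (Arr GuessPos (Var Slot))) (set_var Slot k s1)"
    have s2: "ar s2 = ar s" "vr s2 Bound = vr s Bound" "vr s2 Pos = q k" "vr s2 Ok = vr s1 Ok"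
      using I by (simp_all add: s2_def q_def)
    have "ar (run check_clause s2) = ar s"
      using s2 by (intro ext) (simp add: ar_run check_clause_def del: run.simps)
    moreover have "vr (run check_clause s2) Bound = vr s Bound"
      using s2 by (simp add: vr_run check_clause_def del: run.simps)
    moreover have "vr (run check_clause s2) Ok > 0 \<longleftrightarrow> vr s1 Ok > 0 \<and> ?ok k"
      unfolding run_check_clause s2 tok_def C_def q_def ..
    ultimately have "?I (Suc k) (run check_clause s2)"
      using I by (auto simp: less_Suc_eq)
    then show "?I (Suc k) (run (Assign Pos (Arr GuessPos (Var Slot)) ;; check_clause) (set_var Slot k s1))"
      by (simp only: s2_def run.simps)
  qed simp_all
  then show ?thesis
    by blast
qed

lemma run_record_best:
  fixes s :: state
  assumes n: "vr s NumJobs \<le> vr s Bound"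
  obtains (recorded) s' where "run record_best s = s'" "vr s Ok > 0"
      "vr s Found = 0 \<or> vr s Cost < vr s BestCost"
      "vr s' Found > 0" "vr s' BestCost = vr s Cost"
      "\<And>j. j \<in> {1..vr s NumJobs} \<Longrightarrow> ar s' Best j = ar s Compl j"
  | (kept) "run record_best s = s" "vr s Ok = 0 \<or> vr s Found > 0 \<and> vr s BestCost \<le> vr s Cost"
proof (cases "vr s Ok > 0 \<and> (vr s Found = 0 \<or> vr s Cost < vr s BestCost)")
  case True
  define s1 where "s1 = run (Assign Found (Num 1) ;; Assign BestCost (Var Cost)) s"
  define s' where "s' = run (For Idx (capped (Var NumJobs))
     (Write Best (incr (Var Idx)) (Arr Compl (incr (Var Idx))))) s1"
  let ?I = "\<lambda>k s'. vr s' Found = 1 \<and> vr s' BestCost = vr s Cost \<and> ar s' Compl = ar s Compl \<and>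
    (\<forall>j\<in>{1..k}. ar s' Best j = ar s Compl j)"
  have "?I (vr s NumJobs) s'"
    unfolding s'_def
    by (rule run_For_invariant[where I = ?I]) (use n in \<open>auto simp: s1_def le_Suc_eq\<close>)
  moreover have "run record_best s = s'"
    using True by (auto simp: record_best_def s'_def s1_def)
  ultimately show thesis
    using True by (intro recorded[of s']) auto
next
  case False
  then show thesis
    by (intro kept) (auto simp: record_best_def)
qed

subsection \<open>One guess\<close>

definition try_guess :: "objective \<Rightarrow> nat \<Rightarrow> cmd" where
  "try_guess \<gamma> c = clear ;; fix_successors c ;; count_fixed ;; edf ;; check_slots \<gamma> ;;
     check_clauses c ;; record_best"

lemma frames:
  "written clear = {Compl, Due, Load_at}" "assigned clear = {Idx}"
  "written (fix_successors c) = {Compl, Due}"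
  "assigned (fix_successors c) = {Slot, Pos, Time, Count, Job}"
  "written count_fixed = {Load_at}" "assigned count_fixed = {Ok, Idx, Job}"
  "written edf = {Compl, Load_at}" "assigned edf = {Deadline, Idx, Job, Place, Time}"
  "written (check_slots \<gamma>) = {}" "assigned (check_slots \<gamma>) = {Cost, Idx, Job, Ok}"
  "written (check_clauses c) = {}" "assigned (check_clauses c) = {Slot, Pos, Count, Ok}"
  "written record_best = {Best}" "assigned record_best = {Found, BestCost, Idx}"
  by (cases \<gamma>; auto simp: build_defs check_slots_def check_clauses_def check_clause_def
    record_best_def)+

lemma try_guess_frame:
  "written (try_guess \<gamma> c) = {Compl, Due, Load_at, Best}"
  "assigned (try_guess \<gamma> c) =
     {Idx, Slot, Pos, Time, Count, Job, Ok, Place, Deadline, Cost, Found, BestCost}"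
  by (auto simp: try_guess_def frames)

lemma try_guess_shape: "silent (try_guess \<gamma> c)" "fixed_bounds (try_guess \<gamma> c)"
  by (cases \<gamma>; simp add: try_guess_def build_defs check_slots_def check_clauses_def
    check_clause_def record_best_def)+

text \<open>Well-formed formulas mention jobs only. Used to pass from \<open>Compl\<close> to
  \<open>Best\<close>, which agree just on the jobs.\<close>

lemma feasible_cong:
  assumes "I \<in> instances" "\<And>j. j \<in> jobs I \<Longrightarrow> C j = C' j"
  shows "feasible I C \<longleftrightarrow> feasible I C'"
proof -
  have load: "{j \<in> jobs I. C j = t} = {j \<in> jobs I. C' j = t}" for t
    using assms(2) by auto
  have "sat (\<lambda>i. C i < C j) (constr I j) \<longleftrightarrow> sat (\<lambda>i. C' i < C' j) (constr I j)" if "j \<in> jobs I" for j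
  proof -
    have "wf_formula (jobs I) (constr I j)"
      using assms(1) that by (simp add: instances_def)
    then have "C i < C j \<longleftrightarrow> C' i < C' j" if "constr I j = DNF F" "K \<in> set F" "i \<in> set K" for F K i
      using that assms(2) \<open>j \<in> jobs I\<close> by (auto simp: subset_iff)
    then show ?thesis
      by (cases "constr I j") auto
  qed
  then show ?thesis
    using assms(2) by (simp add: feasible_def is_schedule_def load)
qed

lemma cost_cong:
  assumes "\<And>j. j \<in> jobs I \<Longrightarrow> C j = C' j"
  shows "cost \<gamma> I C = cost \<gamma> I C'"
proof -
  have "C ` jobs I = C' ` jobs I"
    using assms by (rule image_cong[OF refl])
  then show ?thesis
    using assms by (cases \<gamma>) simp_all
qed

abbreviation all_clauses :: "sched_instance \<Rightarrow> (nat \<times> nat list) set" where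
  "all_clauses I \<equiv> \<Union>j\<in>jobs I. clauses j (constr I j)"

lemma all_clausesD:
  assumes "I \<in> instances" "(j, K) \<in> all_clauses I"
  shows "j \<in> jobs I" "constr I j \<noteq> One" "set K \<subseteq> jobs I" "\<exists>F. constr I j = DNF F \<and> K \<in> set F"
proof -
  obtain j' where j': "j' \<in> jobs I" "(j, K) \<in> clauses j' (constr I j')"
    using assms(2) by blast
  then obtain F where F: "constr I j' = DNF F" "K \<in> set F" "j = j'"
    by (cases "constr I j'") auto
  then show "j \<in> jobs I" "constr I j \<noteq> One" "\<exists>F. constr I j = DNF F \<and> K \<in> set F"
    using j' by auto
  have "wf_formula (jobs I) (constr I j')"
    using assms(1) j' by (simp add: instances_def)
  with F show "set K \<subseteq> jobs I"
    by simp
qed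

text \<open>The guess \<open>(q, t)\<close> assigns to every successor the address of a conjunction satisfied by the
  schedule \<open>T\<close> and its time in \<open>T\<close>. Entries with \<open>q r = 0\<close> are unused.\<close>

definition describes :: "sched_instance \<Rightarrow> (nat \<Rightarrow> nat) \<Rightarrow> nat \<Rightarrow> (nat \<Rightarrow> nat) \<Rightarrow> (nat \<Rightarrow> nat) \<Rightarrow>
    (nat \<Rightarrow> nat) \<Rightarrow> (nat \<Rightarrow> nat) \<Rightarrow> bool" where
  "describes I T c tok own q t \<longleftrightarrow>
     (\<forall>r<c. q r \<noteq> 0 \<longrightarrow> t r = T (own (q r)) \<and> own (q r) \<noteq> 0 \<and>
        (\<forall>l<tok (q r). T (tok (q r + 1 + l)) < T (own (q r)))) \<and>
     (\<forall>j\<in>jobs I. constr I j \<noteq> One \<longrightarrow> (\<exists>r<c. own (q r) = j))"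

text \<open>The condition on \<open>GuessTime\<close> keeps fixed times and lowered due dates below
  \<open>Bound\<close>, whatever the guess; entries not yet written are 0 and satisfy it as
  well.\<close>

definition search_inv :: "objective \<Rightarrow> sched_instance \<Rightarrow> state \<Rightarrow> bool" where
  "search_inv \<gamma> I s \<longleftrightarrow> represents_instance I s \<and> (\<forall>r. ar s GuessTime r < vr s Bound) \<and> outq s = [] \<and>
     (vr s Found > 0 \<longrightarrow> feasible I (ar s Best) \<and> vr s BestCost = cost \<gamma> I (ar s Best))"

definition found_within :: "nat \<Rightarrow> state \<Rightarrow> bool" where
  "found_within x s \<longleftrightarrow> vr s Found > 0 \<and> vr s BestCost \<le> x"

locale guessed =
  fixes \<gamma> :: objective and I :: sched_instance and c :: nat and s :: state
  assumes inst: "I \<in> instances" and inv: "search_inv \<gamma> I s"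
begin

abbreviation "n \<equiv> num_jobs I"
abbreviation "m \<equiv> machines I"
abbreviation "N \<equiv> vr s Bound"
abbreviation "tok \<equiv> ar s Token"
abbreviation "own \<equiv> ar s Owner"
abbreviation "q \<equiv> ar s GuessPos"
abbreviation "t \<equiv> ar s GuessTime"

lemma instance_facts:
  shows "vr s NumJobs = n" "vr s Machines = m" "n + 2 \<le> N" "1 \<le> n"
    "j \<in> jobs I \<Longrightarrow> ar s Succ j = (if constr I j = One then 0 else 1)"
    "t r < N" "tok 0 = 0" "own 0 = 0"
  using inv inst by (auto simp: search_inv_def represents_instance_def instances_def layout_def)

lemma owner:
  assumes "own p \<noteq> 0"
  obtains K where "(own p, K) \<in> all_clauses I" "length K < N" "clause_at tok p K"
proof -
  obtain P where P: "layout (all_clauses I) P tok own" "N = P + n + 2"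
    using inv by (auto simp: search_inv_def represents_instance_def)
  from layout_owner[OF P(1) assms] P(2) that show thesis
    by (metis add.assoc add_lessD1 le_add1 less_le_trans add.commute)
qed

definition "s1 = run clear s"
definition "s2 = run (fix_successors c) s1"
definition "s3 = run count_fixed s2"
definition "s4 = run edf s3"
definition "s5 = run (check_slots \<gamma>) s4"
definition "s6 = run (check_clauses c) s5"

lemma run_try_guess: "run (try_guess \<gamma> c) s = run record_best s6"
  by (simp add: try_guess_def s1_def s2_def s3_def s4_def s5_def s6_def)

lemma stages:
  "x \<in> {NumJobs, Machines, Bound, Found, BestCost} \<Longrightarrow> vr s1 x = vr s x \<and> vr s2 x = vr s x \<and>
     vr s3 x = vr s x \<and> vr s4 x = vr s x \<and> vr s5 x = vr s x \<and> vr s6 x = vr s x"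
  "a \<in> {Token, Owner, Succ, GuessPos, GuessTime, Best} \<Longrightarrow> ar s1 a = ar s a \<and> ar s2 a = ar s a \<and>
     ar s3 a = ar s a \<and> ar s4 a = ar s a \<and> ar s5 a = ar s a \<and> ar s6 a = ar s a"
  "ar s3 Compl = ar s2 Compl" "ar s3 Due = ar s2 Due" "ar s5 Compl = ar s4 Compl"
  "ar s6 Compl = ar s4 Compl" "vr s4 Ok = vr s3 Ok" "vr s6 Cost = vr s5 Cost"
  by (auto simp: s1_def s2_def s3_def s4_def s5_def s6_def vr_run ar_run frames)

lemma fixed_cases:
  assumes "j \<in> jobs I"
  obtains "ar s2 Compl j = 0"
  | r where "r < c" "own (q r) = j" "ar s2 Compl j = t r"
  using run_fix_successors(1)[of c s1 j, folded s2_def] assms stages(2) run_clear(1)[of j s]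
    instance_facts(3) by (fastforce simp: jobs_def s1_def)

lemma due_cases:
  assumes "i \<in> jobs I"
  obtains "ar s2 Due i = N - 1"
  | r l where "r < c" "ar s2 Due i = t r" "l < tok (q r)" "tok (q r + 1 + l) = i"
  using run_fix_successors(3)[of c s1 i, folded s2_def] assms stages(2) run_clear(2)[of i s]
    instance_facts(3) by (fastforce simp: jobs_def s1_def)

lemma load_fixed:
  assumes "1 \<le> t'" "t' < N"
  shows "ar s3 Load_at t' = card {j \<in> {1..n}. ar s2 Compl j = t'}"
proof -
  have "ar s2 Load_at t' = 0"
    using assms run_clear(3)[of t' s]
    by (simp add: s2_def ar_run frames s1_def)
  then show ?thesis
    using run_count_fixed(2)[of s2 t', folded s3_def] assms stages(1) instance_facts by simp
qed

lemma covered: "vr s3 Ok > 0 \<longleftrightarrow> (\<forall>j\<in>jobs I. ar s2 Compl j > 0 \<or> constr I j = One)"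
proof -
  have "vr s2 NumJobs = n" "n \<le> vr s2 Bound" "ar s2 Succ = ar s Succ"
    using stages(1,2) instance_facts(1,3) by simp_all
  then have "vr s3 Ok > 0 \<longleftrightarrow> (\<forall>j\<in>jobs I. ar s2 Compl j > 0 \<or> ar s Succ j = 0)"
    using run_count_fixed(1)[of s2, folded s3_def] by (simp add: jobs_def)
  also have "\<dots> \<longleftrightarrow> (\<forall>j\<in>jobs I. ar s2 Compl j > 0 \<or> constr I j = One)"
    by (intro ball_cong) (simp_all add: instance_facts(5))
  finally show ?thesis .
qed

lemma ok_iff:
  "vr s6 Ok > 0 \<longleftrightarrow> vr s3 Ok > 0 \<and>
     (\<forall>j\<in>jobs I. ar s4 Compl j > 0 \<and> ar s4 Load_at (ar s4 Compl j) \<le> m) \<and>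
     (\<forall>r<c. \<forall>l < N - (N - tok (q r)). ar s4 Compl (tok (q r + 1 + l)) < ar s4 Compl (own (q r)))"
  using run_check_slots(1)[of s4 I \<gamma>, folded s5_def] run_check_clauses[of c s5, folded s6_def]
    stages instance_facts by simp

lemma cost_eq: "vr s6 Cost = cost \<gamma> I (ar s4 Compl)"
  using run_check_slots(2)[of s4 I \<gamma>, folded s5_def] stages instance_facts by simp

text \<open>True for every guess, since \<open>edf\<close> updates \<open>Compl\<close> and
  \<open>Load_at\<close> together. It is what turns the test of \<open>Load_at\<close> in
  \<open>check_slots\<close> into a test of the machine capacity.\<close>

lemma slots:
  shows "j \<in> jobs I \<Longrightarrow> ar s4 Compl j < N"
    "1 \<le> t' \<Longrightarrow> t' < N \<Longrightarrow> ar s4 Load_at t' = card {j \<in> jobs I. ar s4 Compl j = t'}"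
proof -
  let ?P = "\<lambda>d i C L. (\<forall>j\<in>{1..n}. C j < N) \<and>
    (\<forall>t. 1 \<le> t \<and> t < N \<longrightarrow> L t = card {j \<in> {1..n}. C j = t})"
  have "ar s2 Compl j < N" if "j \<in> jobs I" for j
    using that instance_facts by (cases rule: fixed_cases[OF that]) auto
  then have init: "?P 0 0 (ar s3 Compl) (ar s3 Load_at)"
    using load_fixed stages(3) by (simp add: jobs_def)
  have "?P (vr s3 Bound) 0 (ar (run edf s3) Compl) (ar (run edf s3) Load_at)"
  proof (rule run_edf[where P = ?P])
    fix d i C L p
    assume i: "i < vr s3 NumJobs" and P: "?P d i C L" and C: "C (Suc i) = 0"
      and p: "p \<noteq> 0 \<longrightarrow> p < vr s3 Bound \<and> L p < vr s3 Machines \<and>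
        (\<forall>t. 1 \<le> t \<and> t < p \<longrightarrow> vr s3 Machines \<le> L t)"
    have "card {j \<in> {1..n}. (C(Suc i := p)) j = t} =
        card {j \<in> {1..n}. C j = t} + (if t = p then 1 else 0)" if "1 \<le> t" for t
      using that i C stages(1) instance_facts by (intro card_fibre_upd) auto
    then show "?P d (Suc i) (C(Suc i := p)) (L(p := L p + 1))"
      using P p stages(1) instance_facts by auto
  qed (use init stages(1) instance_facts in auto)
  then show "j \<in> jobs I \<Longrightarrow> ar s4 Compl j < N"
    "1 \<le> t' \<Longrightarrow> t' < N \<Longrightarrow> ar s4 Load_at t' = card {j \<in> jobs I. ar s4 Compl j = t'}"
    by (simp_all add: s4_def jobs_def)
qed

text \<open>A successor with a fixed time got it from a slot that it owns. The nonzero owner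
  identifies the guessed address as the start of one of its conjunctions, and
  \<open>check_clauses\<close> has tested exactly that conjunction.\<close>

lemma sound:
  assumes "vr s6 Ok > 0"
  shows "feasible I (ar s4 Compl)"
proof -
  let ?C = "ar s4 Compl"
  note ok = assms[unfolded ok_iff covered]
  have "card {j \<in> jobs I. ?C j = t'} \<le> m" for t'
  proof (cases "\<exists>j\<in>jobs I. ?C j = t'")
    case True
    then obtain j where j: "j \<in> jobs I" "?C j = t'"
      by blast
    with ok have "1 \<le> t'" "ar s4 Load_at t' \<le> m"
      by (auto simp: Suc_le_eq)
    with slots(1)[OF j(1)] slots(2)[of t'] j show ?thesis
      by simp
  next
    case False
    then have "{j \<in> jobs I. ?C j = t'} = {}"
      by blast
    then show ?thesis
      by (simp only: card.empty)
  qed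
  moreover have "sat (\<lambda>i. ?C i < ?C j) (constr I j)" if j: "j \<in> jobs I" for j
  proof (cases "constr I j = One")
    case False
    with ok j have "ar s2 Compl j > 0"
      by blast
    with fixed_cases[OF j] obtain r where r: "r < c" "own (q r) = j"
      by (metis less_irrefl)
    have "own (q r) \<noteq> 0"
      using r j by (simp add: jobs_def)
    then obtain K where K: "(own (q r), K) \<in> all_clauses I" "length K < N" "clause_at tok (q r) K"
      by (rule owner)
    obtain F where F: "constr I j = DNF F" "K \<in> set F"
      using all_clausesD(4)[OF inst K(1)] r by auto
    have len: "tok (q r) = length K"
      using K(3) by (simp add: clause_at_def)
    have "?C (K ! l) < ?C j" if "l < length K" for l
    proof -
      \<comment> \<open>As \<open>length K < N\<close>, the capped loop has run through all
        literals.\<close>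
      have "?C (tok (q r + 1 + l)) < ?C (own (q r))"
        using ok r(1) that K(2) len by simp
      with r K(3) that show ?thesis
        by (simp add: clause_at_def)
    qed
    then have "\<forall>i\<in>set K. ?C i < ?C j"
      by (auto simp: in_set_conv_nth)
    with F show ?thesis
      by auto
  qed simp
  ultimately show ?thesis
    using ok by (auto simp: feasible_def is_schedule_def Suc_le_eq)
qed

text \<open>For the right guess, the arrays after \<open>fix_successors\<close> are an instance of
  \<open>fixed_successors\<close> with \<open>T\<close> as witness. The tests pass because slots are
  within capacity and every literal is completed before its due date, which is at most the time of
  the successor that relies on it.\<close>

lemma complete:
  assumes feas: "feasible I T" and T_le: "\<And>j. j \<in> jobs I \<Longrightarrow> T j \<le> n"
    and desc: "describes I T c tok own q t"
  shows "vr s6 Ok > 0" "cost \<gamma> I (ar s4 Compl) \<le> cost \<gamma> I T"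
proof -
  define S where "S = {j \<in> jobs I. constr I j \<noteq> One}"
  let ?D = "ar s2 Due" and ?C = "ar s4 Compl"
  have pos: "q r \<noteq> 0" if "own (q r) \<noteq> 0" for r
    using that instance_facts(8) by (metis)
  have time: "t r = T (own (q r))" "own (q r) \<noteq> 0"
    "l < tok (q r) \<Longrightarrow> T (tok (q r + 1 + l)) < T (own (q r))" if "r < c" "q r \<noteq> 0" for r l
    using desc that by (auto simp: describes_def)
  have owner_S: "own (q r) \<in> S" if "own (q r) \<noteq> 0" for r
  proof -
    obtain K where K: "(own (q r), K) \<in> all_clauses I" "length K < N" "clause_at tok (q r) K"
      using \<open>own (q r) \<noteq> 0\<close> by (rule owner)
    from all_clausesD(1,2)[OF inst K(1)] show ?thesis
      by (simp add: S_def)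
  qed
  interpret fixed_successors n m N S ?D T
  proof
    show "S \<subseteq> {1..n}"
      by (auto simp: S_def jobs_def)
  next
    fix j assume "j \<in> {1..n}"
    then have j: "j \<in> jobs I"
      by (simp add: jobs_def)
    show "1 \<le> T j"
      using feas j by (auto simp: feasible_def is_schedule_def)
    \<comment> \<open>The default due date exceeds \<open>n\<close>. A lowered one is the time in
      \<open>T\<close> of a successor whose guessed conjunction contains \<open>j\<close> and is
      satisfied by \<open>T\<close>.\<close>
    show "T j < ?D j"
    proof (cases rule: due_cases[OF j])
      case 1
      with T_le[OF j] instance_facts(3) show ?thesis
        by simp
    next
      case (2 r l)
      then have "q r \<noteq> 0"
        using instance_facts(7) by (metis not_less0)
      with 2 time(1)[of r] time(3)[of r l] show ?thesis
        by simp
    qed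
    show "?D j < N"
      using instance_facts by (cases rule: due_cases[OF j]) auto
  next
    fix t' show "card {j \<in> {1..n}. T j = t'} \<le> m"
      using feas by (simp add: feasible_def is_schedule_def jobs_def)
  qed
  \<comment> \<open>All slots owned by the same successor hold the same time, so it does not matter
    which of them was written last.\<close>
  have fixed: "ar s2 Compl j = (if j \<in> S then T j else 0)" if j: "j \<in> jobs I" for j
  proof (cases "j \<in> S")
    case True
    then obtain r where r: "r < c" "own (q r) = j"
      using desc by (auto simp: describes_def S_def)
    then obtain r' where r': "r' < c" "own (q r') = j" "ar s2 Compl j = t r'"
      using run_fix_successors(2)[of r c s1, folded s2_def] stages(2) by auto
    moreover have "j \<noteq> 0"
      using j by (simp add: jobs_def)
    ultimately show ?thesis
      using True time(1)[of r'] pos[of r'] by simp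
  next
    case False
    have "j \<noteq> 0"
      using j by (simp add: jobs_def)
    with False show ?thesis
      using fixed_cases[OF j] owner_S by metis
  qed
  have init: "edf_inv 0 0 (ar s3 Compl) (ar s3 Load_at)"
    unfolding edf_inv_def stages(3)
  proof (intro conjI allI impI ballI)
    fix t' assume t': "1 \<le> t' \<and> t' < N"
    then show load: "ar s3 Load_at t' = card {j \<in> {1..n}. ar s2 Compl j = t'}"
      using load_fixed by simp
    have "{j \<in> {1..n}. ar s2 Compl j = t'} \<subseteq> {j \<in> {1..n}. T j = t'}"
      using fixed t' by (auto simp: jobs_def split: if_splits)
    then have "card {j \<in> {1..n}. ar s2 Compl j = t'} \<le> card {j \<in> {1..n}. T j = t'}"
      by (intro card_mono) auto
    with load T_load[of t'] show "ar s3 Load_at t' \<le> m"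
      by linarith
  qed (use fixed in \<open>auto simp: jobs_def S_def\<close>)
  have fin: "edf_inv N 0 ?C (ar s4 Load_at)"
  proof -
    have "edf_inv (vr s3 Bound) 0 (ar (run edf s3) Compl) (ar (run edf s3) Load_at)"
    proof (rule run_edf[where P = edf_inv])
      show "edf_inv d (Suc i) C L" if "edf_inv d i C L" "C (Suc i) \<noteq> 0 \<or> d < ar s3 Due (Suc i)"
        for d i C L
        using that edf_inv_skip stages(4) by simp
      show "edf_inv d (Suc i) (C(Suc i := p)) (L(p := L p + 1))"
        if "i < vr s3 NumJobs" "edf_inv d i C L" "C (Suc i) = 0" "ar s3 Due (Suc i) \<le> d"
          "p = 0 \<longrightarrow> (\<forall>t. 1 \<le> t \<and> t < vr s3 Bound \<longrightarrow> vr s3 Machines \<le> L t)"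
          "p \<noteq> 0 \<longrightarrow> p < vr s3 Bound \<and> L p < vr s3 Machines \<and>
            (\<forall>t. 1 \<le> t \<and> t < p \<longrightarrow> vr s3 Machines \<le> L t)"
        for d i C L p
        using that stages(1,4) instance_facts by (intro edf_inv_place) auto
    qed (use init edf_inv_next stages(1) instance_facts in auto)
    then show ?thesis
      using stages(1) by (simp add: s4_def)
  qed
  have C: "1 \<le> ?C j" "?C j < ?D j" if "j \<in> jobs I" for j
    using that edf_pos[OF fin] edf_less_due[OF fin] by (simp_all add: jobs_def)
  show "vr s6 Ok > 0"
    unfolding ok_iff covered
  proof (intro conjI ballI allI impI)
    fix j assume j: "j \<in> jobs I"
    show "ar s2 Compl j > 0 \<or> constr I j = One"
      using fixed[OF j] j T_pos[of j] by (auto simp: S_def jobs_def)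
    show "?C j > 0"
      using C(1)[OF j] by simp
    show "ar s4 Load_at (?C j) \<le> m"
      using edf_invD(2)[OF fin C(1)[OF j]] slots(1)[OF j] by blast
  next
    fix r l assume r: "r < c" and l: "l < N - (N - tok (q r))"
    then have l': "l < tok (q r)" "l < N"
      by simp_all
    then have "q r \<noteq> 0"
      using instance_facts(7) by (metis not_less0)
    then have own: "own (q r) \<noteq> 0" "t r = T (own (q r))"
      using time r by auto
    obtain K where K: "(own (q r), K) \<in> all_clauses I" "length K < N" "clause_at tok (q r) K"
      using own(1) by (rule owner)
    have "tok (q r + 1 + l) \<in> set K"
      using K(3) l' by (simp add: clause_at_def)
    then have "tok (q r + 1 + l) \<in> jobs I"
      using all_clausesD(3)[OF inst K(1)] by blast
    then have "?C (tok (q r + 1 + l)) < ?D (tok (q r + 1 + l))"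
      by (rule C)
    also have "\<dots> \<le> t r"
      using run_fix_successors(4)[of r c l s1, folded s2_def] r l' stages by simp
    also have "t r = ?C (own (q r))"
      using own edf_invD(3)[OF fin owner_S] by simp
    finally show "?C (tok (q r + 1 + l)) < ?C (own (q r))" .
  qed
  show "cost \<gamma> I ?C \<le> cost \<gamma> I T"
    using edf_dominates[OF fin] instance_facts(4) by (intro cost_mono_if_dominated) (simp_all add: jobs_def)
qed

lemma search_inv_try_guess: "search_inv \<gamma> I (run (try_guess \<gamma> c) s)"
proof -
  let ?s = "run (try_guess \<gamma> c) s"
  have "represents_instance I ?s" "\<forall>r. ar ?s GuessTime r < vr ?s Bound" "outq ?s = []"
    using inv by (simp_all add: search_inv_def represents_instance_def vr_run ar_run outq_run
      try_guess_frame try_guess_shape)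
  moreover have "feasible I (ar ?s Best) \<and> vr ?s BestCost = cost \<gamma> I (ar ?s Best)" if "vr ?s Found > 0"
  proof -
    have "vr s6 NumJobs \<le> vr s6 Bound"
      using stages(1) instance_facts by simp
    then show ?thesis
    proof (cases rule: run_record_best)
      case (recorded s')
      then have "ar s' Best j = ar s4 Compl j" if "j \<in> jobs I" for j
        using that stages instance_facts by (simp add: jobs_def)
      then show ?thesis
        using recorded sound feasible_cong[OF inst, of "ar s' Best" "ar s4 Compl"]
          cost_cong[of I "ar s' Best" "ar s4 Compl" \<gamma>] cost_eq by (simp add: run_try_guess)
    next
      case kept
      then show ?thesis
        using that inv stages by (simp add: run_try_guess search_inv_def)
    qed
  qed
  ultimately show ?thesis
    by (simp add: search_inv_def)
qed

lemma found_within_try_guess: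
  assumes "found_within x s \<or> vr s6 Ok > 0 \<and> cost \<gamma> I (ar s4 Compl) \<le> x"
  shows "found_within x (run (try_guess \<gamma> c) s)"
proof -
  have "vr s6 NumJobs \<le> vr s6 Bound"
    using stages(1) instance_facts by simp
  moreover have found: "vr s6 Found = vr s Found" "vr s6 BestCost = vr s BestCost"
    using stages(1) by simp_all
  ultimately show ?thesis
  proof (cases rule: run_record_best)
    case (recorded s')
    then show ?thesis
      using assms cost_eq found by (auto simp: run_try_guess found_within_def)
  next
    case kept
    then show ?thesis
      using assms cost_eq found by (auto simp: run_try_guess found_within_def)
  qed
qed

end

subsection \<open>Trying all guesses\<close>

definition guess_entry :: "array \<Rightarrow> nat \<Rightarrow> cmd \<Rightarrow> cmd" where
  "guess_entry a k b = For Guess (Var Bound) (Write a (Num k) (Var Guess) ;; b)"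

primrec search :: "cmd \<Rightarrow> nat \<Rightarrow> cmd" where
  "search b 0 = b"
| "search b (Suc k) = guess_entry GuessPos k (guess_entry GuessTime k (search b k))"

lemma search_frame:
  "assigned (search b k) \<subseteq> insert Guess (assigned b)"
  "silent b \<Longrightarrow> silent (search b k)" "fixed_bounds b \<Longrightarrow> fixed_bounds (search b k)"
  by (induction k) (auto simp: guess_entry_def)

text \<open>\<open>J\<close> holds throughout, \<open>F\<close> is the goal, which is never lost
  once reached, and \<open>H\<close> says that the entries chosen by outer loops are right. The goal
  is reached in the round in which the loop variable equals \<open>x\<close>.\<close>

lemma run_guess_entry:
  fixes J F H :: "state \<Rightarrow> bool"
  assumes J: "J s" and x: "x < vr s Bound" and N: "\<And>s'. J s' \<Longrightarrow> vr s' Bound = vr s Bound"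
    and upd: "\<And>i s'. i < vr s Bound \<Longrightarrow> J s' \<Longrightarrow> J (run (Write a (Num k) (Var Guess)) (set_var Guess i s'))"
      "\<And>i s'. F s' \<Longrightarrow> F (run (Write a (Num k) (Var Guess)) (set_var Guess i s'))"
      "\<And>i s'. H s' \<Longrightarrow> H (run (Write a (Num k) (Var Guess)) (set_var Guess i s'))"
    and body: "\<And>s'. J s' \<Longrightarrow> J (run b s')" "\<And>s'. J s' \<Longrightarrow> F s' \<Longrightarrow> F (run b s')"
      "\<And>s'. J s' \<Longrightarrow> H s' \<Longrightarrow> H (run b s')"
      "\<And>s'. J s' \<Longrightarrow> H s' \<Longrightarrow> ar s' a k = x \<Longrightarrow> F (run b s')"
  shows "J (run (guess_entry a k b) s)" "F s \<or> H s \<Longrightarrow> F (run (guess_entry a k b) s)"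
proof -
  let ?I = "\<lambda>i s'. J s' \<and> (F s \<longrightarrow> F s') \<and> (H s \<longrightarrow> H s' \<and> (x < i \<longrightarrow> F s'))"
  have "?I (vr s Bound) (run (guess_entry a k b) s)"
    unfolding guess_entry_def
  proof (rule run_For_invariant[where I = ?I])
    fix i and s' :: state assume i: "i < vr s Bound" and I: "?I i s'"
    let ?s = "run (Write a (Num k) (Var Guess)) (set_var Guess i s')"
    have "J ?s" "F s' \<longrightarrow> F ?s" "H s' \<longrightarrow> H ?s" "ar ?s a k = i"
      using upd(1)[OF i, of s'] upd(2,3)[of s' i] I by simp_all
    then have "?I (Suc i) (run b ?s)"
      using I body[of ?s] by (auto simp: less_Suc_eq)
    then show "?I (Suc i) (run (Write a (Num k) (Var Guess) ;; b) (set_var Guess i s'))"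
      by simp
  qed (use J in simp_all)
  then show "J (run (guess_entry a k b) s)" "F s \<or> H s \<Longrightarrow> F (run (guess_entry a k b) s)"
    using x by auto
qed

text \<open>\<open>search b k\<close> chooses only the entries below \<open>k\<close>; those from
  \<open>k\<close> on belong to outer loops.\<close>

lemma search_keeps:
  assumes "a \<in> {GuessPos, GuessTime}" "a \<notin> written b" "k \<le> r"
  shows "ar (run (search b k) s) a r = ar s a r"
  using assms(3)
proof (induction k arbitrary: s)
  case 0
  with assms(2) show ?case
    by (simp add: ar_run)
next
  case (Suc k)
  have keep: "ar (run (guess_entry a' k b') s) a r = ar s a r"
    if "\<And>s. ar (run b' s) a r = ar s a r" for a' b' s
    unfolding guess_entry_def
    by (rule run_For_invariant[where I = "\<lambda>i s'. ar s' a r = ar s a r"])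
      (use that Suc.prems in auto)
  show ?case
    using Suc by (simp add: keep)
qed

text \<open>Entries from \<open>k\<close> on have been chosen when \<open>search b k\<close> starts,
  hence the premise on them. It is vacuous for \<open>k = c\<close>, the case of interest, and for
  \<open>k = 0\<close> it says that the whole guess is right.\<close>

lemma run_search:
  fixes J F :: "state \<Rightarrow> bool" and q t :: "nat \<Rightarrow> nat"
  assumes qt: "\<And>r. r < c \<Longrightarrow> q r < N \<and> t r < N" and N: "\<And>s. J s \<Longrightarrow> vr s Bound = N"
    and upd: "\<And>a k i s. a \<in> {GuessPos, GuessTime} \<Longrightarrow> i < N \<Longrightarrow> J s \<Longrightarrow>
        J (run (Write a (Num k) (Var Guess)) (set_var Guess i s))"
      "\<And>a k i s. F s \<Longrightarrow> F (run (Write a (Num k) (Var Guess)) (set_var Guess i s))"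
    and body: "\<And>s. J s \<Longrightarrow> J (run b s)" "\<And>s. J s \<Longrightarrow> F s \<Longrightarrow> F (run b s)"
      "\<And>s. J s \<Longrightarrow> \<forall>r<c. ar s GuessPos r = q r \<and> ar s GuessTime r = t r \<Longrightarrow> F (run b s)"
    and b: "GuessPos \<notin> written b" "GuessTime \<notin> written b"
    and k: "k \<le> c" and J: "J s"
  shows "J (run (search b k) s) \<and> (F s \<or>
    (\<forall>r. k \<le> r \<and> r < c \<longrightarrow> ar s GuessPos r = q r \<and> ar s GuessTime r = t r) \<longrightarrow> F (run (search b k) s))"
  using k J
proof (induction k arbitrary: s)
  case 0
  then show ?case
    using body by auto
next
  case (Suc k)
  let ?H = "\<lambda>s. \<forall>r. Suc k \<le> r \<and> r < c \<longrightarrow> ar s GuessPos r = q r \<and> ar s GuessTime r = t r"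
  let ?H' = "\<lambda>s. ?H s \<and> ar s GuessPos k = q k"
  have k: "k < c" "k \<le> c"
    using Suc.prems by simp_all
  note IH = Suc.IH[OF k(2)]
  have keeps: "ar (run (search b k) s) GuessPos r = ar s GuessPos r"
    "ar (run (search b k) s) GuessTime r = ar s GuessTime r" if "k \<le> r" for r s
    using search_keeps b that by auto
  have hit: "F (run (search b k) s)" if "J s" "?H' s" "ar s GuessTime k = t k" for s
    using IH[OF that(1)] that(2,3) by (metis Suc_leI le_neq_implies_less)
  have inner: "J (run (guess_entry GuessTime k (search b k)) s)"
    "F s \<or> ?H' s \<Longrightarrow> F (run (guess_entry GuessTime k (search b k)) s)" if "J s" for s
    by (rule run_guess_entry[where J = J and F = F and H = ?H' and x = "t k"],
      use that k qt N upd IH keeps hit in auto)+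
  have keeps': "?H (run (guess_entry GuessTime k (search b k)) s)" if "?H s" for s
    unfolding guess_entry_def
    by (rule run_For_invariant[where I = "\<lambda>i. ?H"]) (use that keeps in auto)
  have "J (run (search b (Suc k)) s)" "F s \<or> ?H s \<Longrightarrow> F (run (search b (Suc k)) s)"
    unfolding search.simps
    by (rule run_guess_entry[where J = J and F = F and H = ?H and x = "q k"],
      use Suc.prems k qt N upd inner keeps' in auto)+
  then show ?case
    by blast
qed

text \<open>Number the successors and give each the address of a conjunction that \<open>T\<close>
  satisfies; the remaining slots get address 0. All times fit below \<open>Bound\<close> because
  \<open>T\<close> is compressed.\<close>

lemma guess_exists:
  assumes inst: "I \<in> instances" and c: "num_successors I \<le> c" and feas: "feasible I T"
    and T_le: "\<And>j. j \<in> jobs I \<Longrightarrow> T j \<le> num_jobs I" and s: "represents_instance I s"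
  obtains q t where "describes I T c (ar s Token) (ar s Owner) q t"
    "\<And>r. q r < vr s Bound" "\<And>r. t r < vr s Bound"
proof -
  let ?tok = "ar s Token" and ?own = "ar s Owner" and ?N = "vr s Bound"
  define S where "S = {j \<in> jobs I. constr I j \<noteq> One}"
  have fin: "finite S" and card: "card S \<le> c"
    using c by (simp_all add: S_def jobs_def num_successors_def)
  obtain P where P: "layout (all_clauses I) P ?tok ?own" "?N = P + num_jobs I + 2"
    using s by (auto simp: represents_instance_def)
  have "\<exists>p. ?own p = j \<and> p < ?N \<and> (\<forall>l<?tok p. T (?tok (p + 1 + l)) < T j)" if j: "j \<in> S" for j
  proof -
    obtain F where F: "constr I j = DNF F"
      using j by (cases "constr I j") (auto simp: S_def)
    have "sat (\<lambda>i. T i < T j) (constr I j)"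
      using feas j by (simp add: feasible_def S_def)
    then obtain K where K: "K \<in> set F" "\<forall>i\<in>set K. T i < T j"
      using F by auto
    have "(j, K) \<in> clauses j (constr I j)"
      using F K by simp
    with j have "(j, K) \<in> all_clauses I"
      unfolding S_def by blast
    with P(1) obtain p where p: "?own p = j" "p + length K < P" "clause_at ?tok p K"
      by (rule layout_address)
    then have "\<forall>l<?tok p. T (?tok (p + 1 + l)) < T j"
      using K(2) by (simp add: clause_at_def)
    with p P(2) show ?thesis
      by (intro exI[of _ p]) simp
  qed
  then obtain p where p: "\<And>j. j \<in> S \<Longrightarrow> ?own (p j) = j"  "\<And>j. j \<in> S \<Longrightarrow> p j < ?N"
    "\<And>j l. j \<in> S \<Longrightarrow> l < ?tok (p j) \<Longrightarrow> T (?tok (p j + 1 + l)) < T j"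
    by metis
  obtain f where f: "bij_betw f {0..<card S} S"
    using ex_bij_betw_nat_finite[OF fin] by blast
  define q where "q r = (if r < card S then p (f r) else 0)" for r
  define t where "t r = (if r < card S then T (f r) else 0)" for r
  have fS: "f r \<in> S" if "r < card S" for r
    using f that by (auto simp: bij_betw_def)
  have pos: "j \<noteq> 0" if "j \<in> S" for j
    using that by (auto simp: S_def jobs_def)
  have "\<exists>r<c. ?own (q r) = j" if "j \<in> S" for j
  proof -
    have "j \<in> f ` {0..<card S}"
      using f that by (simp add: bij_betw_def)
    then obtain r where "r < card S" "f r = j"
      by auto
    with card p(1)[OF that] show ?thesis
      by (intro exI[of _ r]) (simp add: q_def)
  qed
  moreover have "t r = T (?own (q r)) \<and> ?own (q r) \<noteq> 0 \<and>
      (\<forall>l<?tok (q r). T (?tok (q r + 1 + l)) < T (?own (q r)))" if "q r \<noteq> 0" for r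
  proof -
    have r: "r < card S"
      using that by (auto simp: q_def split: if_splits)
    with p[OF fS[OF r]] pos[OF fS[OF r]] show ?thesis
      by (simp add: q_def t_def)
  qed
  ultimately have "describes I T c ?tok ?own q t"
    unfolding describes_def S_def by blast
  moreover have "q r < ?N" for r
    using p(2) fS P(2) by (simp add: q_def)
  moreover have "t r < ?N" for r
  proof (cases "r < card S")
    case True
    then have "f r \<in> jobs I"
      using fS by (auto simp: S_def)
    with True T_le[of "f r"] P(2) show ?thesis
      by (simp add: t_def)
  qed (use P(2) in \<open>simp add: t_def\<close>)
  ultimately show thesis
    by (rule that)
qed

lemma search_inv_write:
  assumes "a \<in> {GuessPos, GuessTime}" "search_inv \<gamma> I s" "i < vr s Bound"
  shows "search_inv \<gamma> I (run (Write a (Num k) (Var Guess)) (set_var Guess i s))"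
  using assms by (auto simp: search_inv_def represents_instance_def)

lemma describes_cong:
  assumes "describes I T c tok own q t" "\<And>r. r < c \<Longrightarrow> q' r = q r" "\<And>r. r < c \<Longrightarrow> t' r = t r"
  shows "describes I T c tok own q' t'"
proof -
  have "\<exists>r<c. own (q' r) = j" if "\<exists>r<c. own (q r) = j" for j
    using that assms(2) by auto
  with assms show ?thesis
    by (simp add: describes_def)
qed

text \<open>Each feasible \<open>C\<close> leads to its own compressed \<open>T\<close> and its own
  guess, but the run is the same for all of them. Hence the one recorded cost is at most the cost of
  every feasible schedule.\<close>

lemma search_optimal:
  assumes inst: "I \<in> instances" and c: "num_successors I \<le> c" and inv: "search_inv \<gamma> I s"
  defines "s' \<equiv> run (search (try_guess \<gamma> c) c) s"
  shows "search_inv \<gamma> I s'" "optimal \<gamma> I (ar s' Best)"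
proof -
  let ?J = "\<lambda>s'. search_inv \<gamma> I s' \<and> vr s' Bound = vr s Bound \<and> ar s' Token = ar s Token \<and>
    ar s' Owner = ar s Owner"
  have main: "search_inv \<gamma> I s' \<and> found_within (cost \<gamma> I C) s'" if C: "feasible I C" for C
  proof -
    obtain T where T: "feasible I T" "\<And>j. j \<in> jobs I \<Longrightarrow> T j \<le> num_jobs I"
      "cost \<gamma> I T \<le> cost \<gamma> I C"
      using compressed_schedule[OF inst C] by blast
    have "represents_instance I s"
      using inv by (simp add: search_inv_def)
    from guess_exists[OF inst c T(1,2) this] obtain q t where
      qt: "describes I T c (ar s Token) (ar s Owner) q t"
      "\<And>r. q r < vr s Bound" "\<And>r. t r < vr s Bound"
      by blast
    have "?J s' \<and> (found_within (cost \<gamma> I T) s \<or>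
      (\<forall>r. c \<le> r \<and> r < c \<longrightarrow> ar s GuessPos r = q r \<and> ar s GuessTime r = t r) \<longrightarrow>
      found_within (cost \<gamma> I T) s')"
      unfolding s'_def
    proof (rule run_search[where J = ?J and N = "vr s Bound" and c = c])
      fix s1 assume J: "?J s1"
      then interpret guessed \<gamma> I c s1
        using inst by unfold_locales blast+
      show "?J (run (try_guess \<gamma> c) s1)"
        using J search_inv_try_guess by (simp add: vr_run ar_run try_guess_frame)
      show "found_within (cost \<gamma> I T) (run (try_guess \<gamma> c) s1)" if "found_within (cost \<gamma> I T) s1"
        using that found_within_try_guess by blast
      assume agree: "\<forall>r<c. ar s1 GuessPos r = q r \<and> ar s1 GuessTime r = t r"
      then have "describes I T c (ar s1 Token) (ar s1 Owner) (ar s1 GuessPos) (ar s1 GuessTime)"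
        using describes_cong[OF qt(1)] J by simp
      then show "found_within (cost \<gamma> I T) (run (try_guess \<gamma> c) s1)"
        using complete[OF T(1,2)] found_within_try_guess by blast
    next
      fix a k i s1 assume "a \<in> {GuessPos, GuessTime}" "i < vr s Bound" "?J s1"
      then show "?J (run (Write a (Num k) (Var Guess)) (set_var Guess i s1))"
        using search_inv_write[of a \<gamma> I s1 i k] by auto
    qed (use qt inv in \<open>auto simp: try_guess_frame found_within_def\<close>)
    then have "search_inv \<gamma> I s'" "found_within (cost \<gamma> I T) s'"
      by auto
    with T(3) show ?thesis
      by (auto simp: found_within_def)
  qed
  obtain C where "feasible I C"
    using inst by (auto simp: instances_def)
  from main[OF this] show inv': "search_inv \<gamma> I s'"
    by simp
  from main[OF \<open>feasible I C\<close>] have "vr s' Found > 0"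
    by (simp add: found_within_def)
  with inv' have best: "feasible I (ar s' Best)" "vr s' BestCost = cost \<gamma> I (ar s' Best)"
    by (auto simp: search_inv_def)
  with main show "optimal \<gamma> I (ar s' Best)"
    unfolding optimal_def found_within_def by metis
qed

subsection \<open>The complete program\<close>

definition print_best :: cmd where
  "print_best = For Idx (capped (Var NumJobs)) (Output (Arr Best (incr (Var Idx))))"

definition solve :: "objective \<Rightarrow> nat \<Rightarrow> cmd" where
  "solve \<gamma> c = search (try_guess \<gamma> c) c ;; print_best"

lemma run_print_best:
  assumes "vr s NumJobs = n" "n \<le> vr s Bound" "outq s = []"
  shows "outq (run print_best s) = map (ar s Best) [1..<n + 1]"
proof -
  let ?I = "\<lambda>k s'. ar s' Best = ar s Best \<and> outq s' = map (ar s Best) [1..<k + 1]"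
  have "?I n (run print_best s)"
    unfolding print_best_def
    by (rule run_For_invariant[where I = ?I]) (use assms in auto)
  then show ?thesis
    by blast
qed

lemma length_le_input_size: "length w \<le> input_size w"
  by (induction w) (auto simp: input_size_def)

lemma time_solve:
  "time (solve \<gamma> c) s \<le> poly (time_poly (solve \<gamma> c)) (vr s Bound)"
proof (rule time_le_poly)
  show "fixed_bounds (solve \<gamma> c)"
    by (simp add: solve_def print_best_def search_frame try_guess_shape)
  show "Bound \<notin> assigned (solve \<gamma> c)"
    using search_frame(1)[of "try_guess \<gamma> c" c]
    by (auto simp: solve_def print_best_def try_guess_frame)
qed

theorem mainTheorem6:
  fixes \<gamma> :: objective and c :: nat
  shows "poly_time_solvable {I \<in> instances. num_successors I \<le> c} encode_instance
           (\<lambda>I. {encode_schedule I C | C. optimal \<gamma> I C})"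
proof -
  let ?P = "compile (read_instance ;; solve \<gamma> c) 0 0"
  \<comment> \<open>\<open>100 * x\<close> covers the reading phase. The rest is polynomial in
    \<open>Bound\<close>, which \<open>read_instance\<close> bounds by
    \<open>2 * x + 3\<close>.\<close>
  let ?p = "[:0, 100:] + pcompose (time_poly (solve \<gamma> c)) [:3, 2:]"
  have solved: "\<exists>C. optimal \<gamma> I C \<and> computes_within ?P (encode_instance I)
      (poly ?p (input_size (encode_instance I))) (encode_schedule I C)"
    if inst: "I \<in> instances" and c: "num_successors I \<le> c" for I
  proof -
    let ?w = "encode_instance I"
    define s where "s = run read_instance (start ?w)"
    note read = read_instance[of I, folded s_def]
    have frame: "x \<notin> assigned read_instance \<Longrightarrow> vr s x = 0"
      "a \<notin> written read_instance \<Longrightarrow> ar s a = (\<lambda>_. 0)" for x a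
      by (simp_all add: s_def vr_run ar_run start_def)
    have "outq s = []"
      unfolding s_def by (subst outq_run)
        (simp_all add: start_def read_instance_def read_formula_def read_clause_def read_literals_def)
    moreover have "vr s Found = 0" "ar s GuessTime = (\<lambda>_. 0)"
      by (intro frame, simp add: read_instance_def read_formula_def read_clause_def read_literals_def)+
    moreover have "0 < vr s Bound"
      using read(1) by (auto simp: represents_instance_def)
    ultimately have "search_inv \<gamma> I s"
      using read(1) by (simp add: search_inv_def)
    define s' where "s' = run (search (try_guess \<gamma> c) c) s"
    have inv': "search_inv \<gamma> I s'" and opt: "optimal \<gamma> I (ar s' Best)"
      unfolding s'_def by (rule search_optimal[OF inst c \<open>search_inv \<gamma> I s\<close>])+
    have "outq (run (solve \<gamma> c) s) = encode_schedule I (ar s' Best)"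
      using inv' run_print_best[of s' "num_jobs I"]
      by (auto simp: solve_def s'_def search_inv_def represents_instance_def encode_schedule_def)
    moreover have "time (read_instance ;; solve \<gamma> c) (start ?w) \<le> poly ?p (input_size ?w)"
    proof -
      have "time (solve \<gamma> c) s \<le> poly (time_poly (solve \<gamma> c)) (vr s Bound)"
        by (rule time_solve)
      also have "\<dots> \<le> poly (time_poly (solve \<gamma> c)) (3 + 2 * input_size ?w)"
        using read(2) length_le_input_size[of ?w] by (intro poly_mono_nat) linarith
      finally show ?thesis
        using read(3) length_le_input_size[of ?w]
        by (simp add: s_def poly_pcompose mult.commute)
    qed
    ultimately show ?thesis
      using computes_within_compile[of "read_instance ;; solve \<gamma> c" ?w] opt
      by (intro exI[of _ "ar s' Best"]) (simp add: s_def)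
  qed
  show ?thesis
    unfolding poly_time_solvable_def
  proof (rule exI[of _ ?P], rule exI[of _ ?p], rule ballI)
    fix I assume "I \<in> {I \<in> instances. num_successors I \<le> c}"
    then obtain C where "optimal \<gamma> I C" "computes_within ?P (encode_instance I)
        (poly ?p (input_size (encode_instance I))) (encode_schedule I C)"
      using solved by blast
    then show "\<exists>y\<in>{encode_schedule I C | C. optimal \<gamma> I C}. computes_within ?P (encode_instance I)
        (poly ?p (input_size (encode_instance I))) y"
      by (intro bexI[of _ "encode_schedule I C"] CollectI exI[of _ C] conjI refl)
  qed
qed

end
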